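(* Let $d \geq 1$, let $q$ be a polynomial on $\mathbf{R}^d$ with real coefficients and degree $m \geq 2$, and let $s, \theta > 0$. Define the operator $T$ by $(Tf)(x) = e^{i q(x)} f(x)$, $x \in \mathbf{R}^d$. (i) If $s \geq (m-1)\theta \geq 1$ then $T$ is continuous on $\mathcal{S}_\theta^s(\mathbf{R}^d)$. (ii) If $s \geq (m-1)\theta \geq 1$ and $(\theta, s) \neq \left(\frac{1}{m-1}, 1\right)$ then $T$ is continuous on $\Sigma_\theta^s(\mathbf{R}^d)$.
   Context: Notation: $\mathbf{N} = \{0,1,2,\dots\}$, $|\alpha| = \sum_j \alpha_j$ for $\alpha \in \mathbf{N}^d$, $D^\beta = i^{-|\beta|}\partial^\beta$. Gelfand--Shilov spaces: for $\theta, s, h > 0$, $\mathcal{S}_{\theta,h}^s(\mathbf{R}^d)$ is the Banach space of all $f \in C^\infty(\mathbf{R}^d)$ such that $$\|f\|_{\mathcal{S}_{\theta,h}^s} = \sup_{\alpha,\beta \in \mathbf{N}^d,\ x \in \mathbf{R}^d} \frac{|x^\alpha D^\beta f(x)|}{h^{|\alpha+\beta|}\, \alpha!^\theta\, \beta!^s} < \infty.$$ The Roumieu space is $\mathcal{S}_\theta^s(\mathbf{R}^d) = \bigcup_{h>0} \mathcal{S}_{\theta,h}^s(\mathbf{R}^d)$ with the (locally convex) inductive limit topology. The Beurling space is $\Sigma_\theta^s(\mathbf{R}^d) = \bigcap_{h>0} \mathcal{S}_{\theta,h}^s(\mathbf{R}^d)$ with the Fréchet space topology defined by the seminorms $\|\cdot\|_{\mathcal{S}_{\theta,h}^s}$,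 $h>0$. "$T$ is continuous on $X$" means that $T$ maps $X$ into $X$ continuously. *)

theory Defs
  imports "HOL-Analysis.Analysis"
begin

section \<open>Multi-indices and polynomials\<close>

type_synonym 'n mindex = "'n \<Rightarrow> nat"

definition mi_abs :: "'n::finite mindex \<Rightarrow> nat"
  where "mi_abs \<alpha> = (\<Sum>j\<in>UNIV. \<alpha> j)"

definition mi_fact :: "'n::finite mindex \<Rightarrow> real"
  where "mi_fact \<alpha> = (\<Prod>j\<in>UNIV. fact (\<alpha> j))"

definition mi_power :: "real^'n \<Rightarrow> 'n::finite mindex \<Rightarrow> real"
  where "mi_power x \<alpha> = (\<Prod>j\<in>UNIV. (x $ j) ^ \<alpha> j)"

definition real_poly_of_degree :: "(real^'n::finite \<Rightarrow> real) \<Rightarrow> nat \<Rightarrow> bool"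
  where "real_poly_of_degree q m \<longleftrightarrow>
    (\<exists>c :: 'n mindex \<Rightarrow> real.
       finite {\<alpha>. c \<alpha> \<noteq> 0} \<and>
       (\<forall>x. q x = (\<Sum>\<alpha> | c \<alpha> \<noteq> 0. c \<alpha> * mi_power x \<alpha>)) \<and>
       (\<exists>\<alpha>. c \<alpha> \<noteq> 0 \<and> mi_abs \<alpha> = m) \<and>
       (\<forall>\<alpha>. c \<alpha> \<noteq> 0 \<longrightarrow> mi_abs \<alpha> \<le> m))"


section \<open>Smooth functions and their partial derivatives\<close>

definition partial_deriv :: "'n \<Rightarrow> (real^'n::finite \<Rightarrow> complex) \<Rightarrow> real^'n \<Rightarrow> complex"
  where "partial_deriv j f x = frechet_derivative f (at x) (axis j 1)"

primrec iter_partial_deriv ::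
    "'n list \<Rightarrow> (real^'n::finite \<Rightarrow> complex) \<Rightarrow> real^'n \<Rightarrow> complex"
  where
    "iter_partial_deriv [] f = f"
  | "iter_partial_deriv (j # js) f = partial_deriv j (iter_partial_deriv js f)"

text \<open>Being infinitely differentiable: every iterated partial derivative is (totally)
  differentiable everywhere, hence in particular continuous.\<close>

definition smooth :: "(real^'n::finite \<Rightarrow> complex) \<Rightarrow> bool"
  where "smooth f \<longleftrightarrow> (\<forall>js x. iter_partial_deriv js f differentiable (at x))"

text \<open>The index type carries no order, so the coordinates are differentiated in an arbitrary
  (but fixed, depending only on \<open>\<beta>\<close>) order in which each \<open>j\<close> occurs \<open>\<beta> j\<close> times.  For smooth
  functions, the only ones to which this is applied, all orders give the same derivative.\<close>

definition mi_partial :: "'n mindex \<Rightarrow> (real^'n::finite \<Rightarrow> complex) \<Rightarrow> real^'n \<Rightarrow> complex"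
  where "mi_partial \<beta> f = iter_partial_deriv (SOME js. \<forall>j. count_list js j = \<beta> j) f"

definition mi_D :: "'n mindex \<Rightarrow> (real^'n::finite \<Rightarrow> complex) \<Rightarrow> real^'n \<Rightarrow> complex"
  where "mi_D \<beta> f x = \<i> powi (- int (mi_abs \<beta>)) * mi_partial \<beta> f x"


section \<open>Gelfand--Shilov spaces\<close>

definition gs_norm ::
    "real \<Rightarrow> real \<Rightarrow> real \<Rightarrow> (real^'n::finite \<Rightarrow> complex) \<Rightarrow> ennreal"
  where "gs_norm \<theta> s h f =
    (SUP (\<alpha>, \<beta>, x) \<in> UNIV.
       ennreal (cmod (complex_of_real (mi_power x \<alpha>) * mi_D \<beta> f x)
         / (h ^ mi_abs (\<lambda>j. \<alpha> j + \<beta> j) * mi_fact \<alpha> powr \<theta> * mi_fact \<beta> powr s)))"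

definition gs_space :: "real \<Rightarrow> real \<Rightarrow> real \<Rightarrow> (real^'n::finite \<Rightarrow> complex) set"
  where "gs_space \<theta> s h = {f. smooth f \<and> gs_norm \<theta> s h f < \<infinity>}"

definition roumieu :: "real \<Rightarrow> real \<Rightarrow> (real^'n::finite \<Rightarrow> complex) set"
  where "roumieu \<theta> s = (\<Union>h\<in>{0<..}. gs_space \<theta> s h)"

definition beurling :: "real \<Rightarrow> real \<Rightarrow> (real^'n::finite \<Rightarrow> complex) set"
  where "beurling \<theta> s = (\<Inter>h\<in>{0<..}. gs_space \<theta> s h)"


section \<open>Topologies\<close>

text \<open>The topology on the function space \<open>V\<close> defined by a nonempty family \<open>P\<close> of seminorms
  that are finite on \<open>V\<close>; the balls form a subbase.\<close>

definition seminorm_topology ::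
    "('a \<Rightarrow> complex) set \<Rightarrow> (('a \<Rightarrow> complex) \<Rightarrow> ennreal) set \<Rightarrow> ('a \<Rightarrow> complex) topology"
  where "seminorm_topology V P =
    topology_generated_by
      {{g \<in> V. p (\<lambda>x. g x - f x) < ennreal e} | p f e. p \<in> P \<and> f \<in> V \<and> e > 0}"

definition gs_topology ::
    "real \<Rightarrow> real \<Rightarrow> real \<Rightarrow> (real^'n::finite \<Rightarrow> complex) topology"
  where "gs_topology \<theta> s h = seminorm_topology (gs_space \<theta> s h) {gs_norm \<theta> s h}"

definition beurling_topology ::
    "real \<Rightarrow> real \<Rightarrow> (real^'n::finite \<Rightarrow> complex) topology"
  where "beurling_topology \<theta> s = seminorm_topology (beurling \<theta> s) (gs_norm \<theta> s ` {0<..})"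

definition convex_funs :: "('a \<Rightarrow> complex) set \<Rightarrow> bool"
  where "convex_funs W \<longleftrightarrow>
    (\<forall>f\<in>W. \<forall>g\<in>W. \<forall>t\<in>{0..1::real}.
       (\<lambda>x. complex_of_real (1 - t) * f x + complex_of_real t * g x) \<in> W)"

text \<open>Locally convex vector space topologies on a complex vector space of functions, under
  pointwise operations.  The continuity of the operations includes that they map the carrier
  into itself.  The Hausdorff property is not part of the definition.\<close>

definition locally_convex_topology :: "('a \<Rightarrow> complex) topology \<Rightarrow> bool"
  where "locally_convex_topology X \<longleftrightarrow>
    (\<lambda>x. 0) \<in> topspace X \<and>
    continuous_map (prod_topology X X) X (\<lambda>(f, g). \<lambda>x. f x + g x) \<and>
    continuous_map (prod_topology euclidean X) X (\<lambda>(c, f). \<lambda>x. c * f x) \<and>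
    (\<forall>U. openin X U \<and> (\<lambda>x. 0) \<in> U \<longrightarrow>
       (\<exists>W. openin X W \<and> convex_funs W \<and> (\<lambda>x. 0) \<in> W \<and> W \<subseteq> U))"

text \<open>The locally convex inductive limit topology is the finest locally convex topology for
  which all the inclusions are continuous, that is, the supremum of all such topologies.
  The indiscrete topology is one of them.\<close>

definition roumieu_topology ::
    "real \<Rightarrow> real \<Rightarrow> (real^'n::finite \<Rightarrow> complex) topology"
  where "roumieu_topology \<theta> s =
    topology_generated_by
      {U. \<exists>X. locally_convex_topology X \<and> topspace X = roumieu \<theta> s \<and>
              (\<forall>h>0. continuous_map (gs_topology \<theta> s h) X id) \<and> openin X U}"

definition exp_mult :: "(real^'n::finite \<Rightarrow> real) \<Rightarrow> (real^'n \<Rightarrow> complex) \<Rightarrow> real^'n \<Rightarrow> complex"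
  where "exp_mult q f x = exp (\<i> * complex_of_real (q x)) * f x"


section \<open>The carriers of the topologies\<close>

text \<open>The topologies live on the intended spaces, so that a \<open>continuous_map\<close> from one of them to
  itself maps the space into itself.\<close>

lemma iter_partial_deriv_zero: "iter_partial_deriv js (\<lambda>x. 0) = (\<lambda>x. 0)"
proof (induction js)
  case (Cons j js)
  then show ?case by (simp add: partial_deriv_def)
qed simp

lemma iter_partial_deriv_lin:
  assumes "smooth f" "smooth g"
  shows "iter_partial_deriv js (\<lambda>x. a * f x + b * g x) = (\<lambda>x. a * iter_partial_deriv js f x + b * iter_partial_deriv js g x)"
proof (induction js)
  case (Cons j js)
  have "(iter_partial_deriv js f has_derivative frechet_derivative (iter_partial_deriv js f) (at x)) (at x)"
   "(iter_partial_deriv js g has_derivative frechet_derivative (iter_partial_deriv js g) (at x)) (at x)" for x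
    using assms by (auto simp: smooth_def frechet_derivative_works)
  then have "((\<lambda>x. a * iter_partial_deriv js f x + b * iter_partial_deriv js g x) has_derivative
     (\<lambda>v. a * frechet_derivative (iter_partial_deriv js f) (at x) v + b * frechet_derivative (iter_partial_deriv js g) (at x) v)) (at x)" for x
    by (intro derivative_intros has_derivative_mult_right)
  from this[THEN frechet_derivative_at] show ?case unfolding iter_partial_deriv.simps Cons partial_deriv_def
    by (metis (no_types, lifting))
qed simp

lemma smooth_lin: "smooth f \<Longrightarrow> smooth g \<Longrightarrow> smooth (\<lambda>x. a * f x + b * g x)"
  unfolding smooth_def[of "\<lambda>x. a * f x + b * g x"]
  by (simp add: iter_partial_deriv_lin) (simp add: smooth_def differentiable_add differentiable_mult)

lemma gs_norm_zero: "gs_norm \<theta> s h (\<lambda>x. 0) = 0"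
  by (simp add: gs_norm_def mi_D_def mi_partial_def iter_partial_deriv_zero case_prod_unfold)

lemma gs_norm_mono:
  fixes f :: "real^'n::finite \<Rightarrow> complex"
  assumes "0 < h" "h \<le> h'"
  shows "gs_norm \<theta> s h' f \<le> gs_norm \<theta> s h f"
proof -
  have pos: "mi_fact \<gamma> > 0" for \<gamma> :: "'n mindex"
    by (auto simp: mi_fact_def intro!: prod_pos)
  have "c / (h' ^ k * mi_fact \<alpha> powr \<theta> * mi_fact \<beta> powr s)
      \<le> c / (h ^ k * mi_fact \<alpha> powr \<theta> * mi_fact \<beta> powr s)"
    if "c \<ge> 0" for c k and \<alpha> \<beta> :: "'n mindex"
  proof (rule divide_left_mono)
    show "h ^ k * mi_fact \<alpha> powr \<theta> * mi_fact \<beta> powr s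
        \<le> h' ^ k * mi_fact \<alpha> powr \<theta> * mi_fact \<beta> powr s"
      using assms by (intro mult_right_mono power_mono) auto
    show "0 < (h' ^ k * mi_fact \<alpha> powr \<theta> * mi_fact \<beta> powr s)
        * (h ^ k * mi_fact \<alpha> powr \<theta> * mi_fact \<beta> powr s)"
      using assms pos[of \<alpha>] pos[of \<beta>] by (auto intro!: mult_pos_pos zero_less_power)
  qed (use that in simp)
  then show ?thesis
    unfolding gs_norm_def by (intro SUP_mono') (auto intro!: ennreal_leI)
qed

lemma gs_norm_lin:
  assumes "h > 0" "smooth f" "smooth g"
  shows "gs_norm \<theta> s h (\<lambda>x. a * f x + b * g x) \<le> ennreal (cmod a) * gs_norm \<theta> s h f + ennreal (cmod b) * gs_norm \<theta> s h g"
  unfolding gs_norm_def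
proof (rule SUP_least, clarify)
  fix \<alpha> \<beta> :: "'a mindex" and x :: "real^'a"
  define w where "w = h ^ mi_abs (\<lambda>j. \<alpha> j + \<beta> j) * mi_fact \<alpha> powr \<theta> * mi_fact \<beta> powr s"
  have w: "w \<ge> 0" using assms by (auto simp: w_def)
  define F G where "F = complex_of_real (mi_power x \<alpha>) * mi_D \<beta> f x"
     and "G = complex_of_real (mi_power x \<alpha>) * mi_D \<beta> g x"
  have e: "complex_of_real (mi_power x \<alpha>) * mi_D \<beta> (\<lambda>x. a * f x + b * g x) x = a * F + b * G"
    by (simp add: mi_D_def mi_partial_def iter_partial_deriv_lin assms algebra_simps F_def G_def)
  have "cmod (a * F + b * G) \<le> cmod a * cmod F + cmod b * cmod G"
    by (metis norm_mult norm_triangle_ineq)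
  then have "cmod (a * F + b * G) / w \<le> cmod a * (cmod F / w) + cmod b * (cmod G / w)"
    using w by (simp add: divide_right_mono add_divide_distrib[symmetric])
  then have "ennreal (cmod (a * F + b * G) / w) \<le> ennreal (cmod a * (cmod F / w) + cmod b * (cmod G / w))"
    by (rule ennreal_leI)
  also have "\<dots> = ennreal (cmod a) * ennreal (cmod F / w) + ennreal (cmod b) * ennreal (cmod G / w)"
    using w by (simp add: ennreal_mult ennreal_plus del: times_divide_eq_right)
  also have "\<dots> \<le> ennreal (cmod a) * gs_norm \<theta> s h f + ennreal (cmod b) * gs_norm \<theta> s h g"
    unfolding gs_norm_def F_def G_def w_def
    by (intro add_mono mult_left_mono SUP_upper2[of "(\<alpha>,\<beta>,x)"]) auto
  finally show "ennreal (cmod (complex_of_real (mi_power x \<alpha>) * mi_D \<beta> (\<lambda>x. a * f x + b * g x) x) / (h ^ mi_abs (\<lambda>j. \<alpha> j + \<beta> j) * mi_fact \<alpha> powr \<theta> * mi_fact \<beta> powr s))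
     \<le> ennreal (cmod a) *
          (SUP (\<alpha>, \<beta>, x)\<in>UNIV. ennreal (cmod (complex_of_real (mi_power x \<alpha>) * mi_D \<beta> f x) / (h ^ mi_abs (\<lambda>j. \<alpha> j + \<beta> j) * mi_fact \<alpha> powr \<theta> * mi_fact \<beta> powr s))) +
          ennreal (cmod b) *
          (SUP (\<alpha>, \<beta>, x)\<in>UNIV. ennreal (cmod (complex_of_real (mi_power x \<alpha>) * mi_D \<beta> g x) / (h ^ mi_abs (\<lambda>j. \<alpha> j + \<beta> j) * mi_fact \<alpha> powr \<theta> * mi_fact \<beta> powr s)))"
    unfolding e w_def gs_norm_def .
qed

lemma roumieu_lin:
  assumes "f \<in> roumieu \<theta> s" "g \<in> roumieu \<theta> s"
  shows "(\<lambda>x. a * f x + b * g x) \<in> roumieu \<theta> s"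
proof -
  from assms obtain h h' where *: "h > 0" "h' > 0" "smooth f" "smooth g" "gs_norm \<theta> s h f < \<infinity>" "gs_norm \<theta> s h' g < \<infinity>"
    by (auto simp: roumieu_def gs_space_def)
  have "gs_norm \<theta> s (max h h') f < \<infinity>" "gs_norm \<theta> s (max h h') g < \<infinity>"
    using gs_norm_mono[of h "max h h'"] gs_norm_mono[of h' "max h h'"] * by (meson max.cobounded1 max.cobounded2 le_less_trans)+
  then have "gs_norm \<theta> s (max h h') (\<lambda>x. a * f x + b * g x) < \<infinity>"
    using * gs_norm_lin[of "max h h'" f g \<theta> s a b]
    by (intro le_less_trans[OF gs_norm_lin]) (auto simp: ennreal_mult_less_top)
  then show ?thesis using * by (auto simp: roumieu_def gs_space_def intro!: smooth_lin bexI[of _ "max h h'"])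
qed

lemma zero_in_gs_space: "(\<lambda>x. 0) \<in> gs_space \<theta> s h"
  by (auto simp: gs_space_def gs_norm_zero smooth_def iter_partial_deriv_zero)

lemma topspace_seminorm_topology:
  assumes "P \<noteq> {}" "\<And>p. p \<in> P \<Longrightarrow> p (\<lambda>x. 0) = 0"
  shows "topspace (seminorm_topology V P) = V"
proof
  obtain p where p: "p \<in> P" using assms by auto
  show "V \<subseteq> topspace (seminorm_topology V P)"
  proof
    fix f assume f: "f \<in> V"
    then have "f \<in> {g \<in> V. p (\<lambda>x. g x - f x) < ennreal 1}" using assms(2)[OF p] by simp
    then show "f \<in> topspace (seminorm_topology V P)" using p f
      unfolding seminorm_topology_def topology_generated_by_topspace
      by (intro UnionI[of "{g \<in> V. p (\<lambda>x. g x - f x) < ennreal 1}"]) (auto intro!: exI[of _ p] exI[of _ f] exI[of _ "1::real"])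
  qed
qed (auto simp: seminorm_topology_def)

lemma topspace_gs_topology [simp]: "topspace (gs_topology \<theta> s h) = gs_space \<theta> s h"
  unfolding gs_topology_def by (rule topspace_seminorm_topology) (auto simp: gs_norm_zero)

lemma topspace_beurling_topology [simp]: "topspace (beurling_topology \<theta> s) = beurling \<theta> s"
  unfolding beurling_topology_def by (rule topspace_seminorm_topology) (auto simp: gs_norm_zero)

lemma topspace_roumieu_topology [simp]:
  "topspace (roumieu_topology \<theta> s) = (roumieu \<theta> s :: (real^'n::finite \<Rightarrow> complex) set)"
proof
  let ?V = "roumieu \<theta> s :: (real^'n::finite \<Rightarrow> complex) set"
  define X where "X = topology_generated_by {?V}"
  have ts: "topspace X = ?V" by (simp add: X_def)
  have z: "(\<lambda>x. 0) \<in> ?V" using zero_in_gs_space by (auto simp: roumieu_def intro!: bexI[of _ 1])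
  have op: "U = {} \<or> U = ?V" if "openin X U" for U
  proof -
    have "generate_topology_on {?V} U" using that by (simp add: X_def openin_topology_generated_by_iff)
    then show ?thesis
    proof induction
      case (UN K) then show ?case by (cases "\<exists>k\<in>K. k = ?V") auto
    qed auto
  qed
  have V: "openin X ?V" by (metis ts openin_topspace)
  have cm: "continuous_map Y X F" if "\<And>y. y \<in> topspace Y \<Longrightarrow> F y \<in> ?V" for Y :: "'b topology" and F
    unfolding X_def by (rule continuous_on_generated_topo) (use that in \<open>auto simp: Int_absorb2 vimage_def Collect_conj_eq subset_eq
      intro!: back_subst[of "openin Y", OF openin_topspace]\<close>)
  have "locally_convex_topology X" unfolding locally_convex_topology_def ts
  proof (intro conjI allI impI z cm)
    fix U assume "openin X U \<and> (\<lambda>x. 0) \<in> U"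
    then have "U = ?V" using op by auto
    then show "\<exists>W. openin X W \<and> convex_funs W \<and> (\<lambda>x. 0) \<in> W \<and> W \<subseteq> U"
      using V z by (auto simp: convex_funs_def roumieu_lin intro!: exI[of _ ?V])
  next
    fix y assume "y \<in> topspace (prod_topology X X)"
    then show "(case y of (f, g) \<Rightarrow> \<lambda>x. f x + g x) \<in> ?V" using roumieu_lin[where a=1 and b=1] by (force simp: ts)
  next
    fix y :: "complex \<times> (real^'n \<Rightarrow> complex)" assume "y \<in> topspace (prod_topology euclidean X)"
    then show "(case y of (c, g) \<Rightarrow> \<lambda>x. c * g x) \<in> ?V" using roumieu_lin[where b=0] by (force simp: ts)
  qed
  moreover have "\<forall>h>0. continuous_map (gs_topology \<theta> s h) X id"
    by (intro allI impI cm) (auto simp: roumieu_def)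
  ultimately show "?V \<subseteq> topspace (roumieu_topology \<theta> s)"
    unfolding roumieu_topology_def topology_generated_by_topspace using V ts by (intro Union_upper) auto
  show "topspace (roumieu_topology \<theta> s) \<subseteq> ?V"
    by (auto simp: roumieu_topology_def dest: openin_subset)
qed

end

theory Submission
  imports Defs
begin

text \<open>
  Everything rests on one inequality: for each \<open>h > 0\<close>, with a constant \<open>K\<close> that does not depend
  on \<open>h\<close>, multiplication by \<open>e\<^sup>i\<^sup>q\<close> is bounded from the Gelfand--Shilov norm with parameter \<open>h\<close>
  to the one with parameter \<open>K (h + h ^ (m - 1))\<close> (\<open>gs_norm_exp_mult_bound\<close>).  In the Roumieu case
  it is enough that the new parameter is some positive number.  In the Beurling case it is enough
  that the new parameter tends to \<open>0\<close> with \<open>h\<close>, which it does because \<open>m \<ge> 2\<close>.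

  For the inequality, consider the functions \<open>e\<^sup>i\<^sup>q x\<^sup>\<mu> \<partial>\<^sub>l\<^sub>s f\<close>.  A partial derivative turns one of
  them into a linear combination of others: it multiplies by a monomial of \<open>i \<partial>\<^sub>j q\<close>, of degree at
  most \<open>m - 1\<close>, or it lowers the monomial \<open>x\<^sup>\<mu>\<close> at the cost of a factor \<open>\<mu>\<^sub>j\<close>, or it differentiates
  \<open>f\<close> once more.  When \<open>n\<close> derivatives are taken, degrees are at most \<open>P = (m - 1) n\<close> and orders
  at most \<open>n\<close>, so factorials may be replaced by powers: \<open>k!\<^sup>\<theta> \<le> (P\<^sup>\<theta>)\<^sup>k\<close> for \<open>k \<le> P\<close>, and
  \<open>l!\<^sup>s \<le> (n\<^sup>s)\<^sup>l\<close> for \<open>l \<le> n\<close>.  After that the size of \<open>x\<^sup>\<mu> \<partial>\<^sub>l\<^sub>s f\<close> is controlled by a geometric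
  weight \<open>\<sigma> ^ \<bar>\<mu>\<bar> \<tau> ^ (length ls)\<close>, where \<open>\<sigma>\<close> is of order \<open>h n\<^sup>\<theta>\<close> and \<open>\<tau> = h n\<^sup>s\<close>, and each derivative
  multiplies the weight by at most
  \<open>\<Lambda> = B \<sigma> ^ (m - 1) + P / \<sigma> + \<tau>\<close> (\<open>iter_partial_deriv_exp_term_bound\<close>).

  The hypotheses on \<open>s\<close> and \<open>\<theta>\<close> enter when \<open>\<Lambda>\<close> is estimated.  The term \<open>\<sigma> ^ (m - 1)\<close> is of order
  \<open>h ^ (m - 1) n powr ((m - 1) \<theta>)\<close>, which \<open>(m - 1) \<theta> \<le> s\<close> bounds by \<open>h ^ (m - 1) n\<^sup>s\<close>, and \<open>P / \<sigma>\<close>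
  is of order \<open>n powr (1 - \<theta>)\<close>, which is \<open>o(n\<^sup>s)\<close> because \<open>s \<ge> (m - 1) \<theta> \<ge> 1\<close>.  Hence
  \<open>\<Lambda> \<le> const (h + h ^ (m - 1)) n\<^sup>s\<close> for large \<open>n\<close>; finitely many \<open>n\<close> only change the constant in front,
  and \<open>n\<^sup>n \<le> e\<^sup>n n!\<close> leads back to factorials (\<open>growth_factor_bound\<close>).

  What is left is formal.  For spaces with a topology given by seminorms the bound is continuity.
  For the inductive limit, the locally convex topologies that define it are stable under pulling
  back along a linear operator which maps every step continuously into some step
  (\<open>continuous_map_roumieu_topology\<close>).
\<close>


section \<open>Partial derivatives of smooth functions commute\<close>

lemma partial_deriv_eqI:
  "(f has_derivative f') (at x) \<Longrightarrow> partial_deriv j f x = f' (axis j 1)"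
  unfolding partial_deriv_def using frechet_derivative_at by metis

lemma smooth_has_derivative:
  "smooth f \<Longrightarrow> (f has_derivative frechet_derivative f (at x)) (at x)"
  using frechet_derivative_works by (metis smooth_def iter_partial_deriv.simps(1))

lemma iter_partial_deriv_append:
  "iter_partial_deriv (xs @ ys) f = iter_partial_deriv xs (iter_partial_deriv ys f)"
  by (induction xs) auto

lemma smooth_iter_partial_deriv: "smooth f \<Longrightarrow> smooth (iter_partial_deriv js f)"
  unfolding smooth_def by (metis iter_partial_deriv_append)

lemma smooth_partial_deriv: "smooth f \<Longrightarrow> smooth (partial_deriv j f)"
  using smooth_iter_partial_deriv[of f "[j]"] by simp

text \<open>A function is smooth as soon as it lies in a class of differentiable functions that partial
  derivatives do not leave; naming such a class gives the smoothness of products and exponentials.\<close>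

lemma smoothI_closed:
  assumes "f \<in> S"
    and diff: "\<And>g x. g \<in> S \<Longrightarrow> g differentiable (at x)"
    and closed: "\<And>g j. g \<in> S \<Longrightarrow> partial_deriv j g \<in> S"
  shows "smooth f"
proof -
  have "iter_partial_deriv js f \<in> S" for js
    by (induction js) (auto simp: assms(1) closed)
  then show ?thesis unfolding smooth_def using diff by blast
qed

text \<open>The mean value theorem in direction \<open>a\<close>, applied to the increment of
  \<open>u\<close> in direction \<open>b\<close>, followed by the mean value theorem in direction
  \<open>b\<close>.\<close>

lemma second_difference_mean_value:
  fixes u :: "'a::real_normed_vector \<Rightarrow> real"
  assumes u: "\<And>x. (u has_derivative U x) (at x)"
    and v: "\<And>x. ((\<lambda>x. U x a) has_derivative V x) (at x)"
    and st: "0 < s" "0 < t"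
  obtains \<xi> \<eta> where "0 < \<xi>" "\<xi> < s" "0 < \<eta>" "\<eta> < t"
    "u (x + s *\<^sub>R a + t *\<^sub>R b) - u (x + s *\<^sub>R a) - u (x + t *\<^sub>R b) + u x
      = s * t * V (x + \<xi> *\<^sub>R a + \<eta> *\<^sub>R b) b"
proof -
  have du: "((\<lambda>r. u (y + r *\<^sub>R a)) has_real_derivative U (y + r *\<^sub>R a) a) (at r)" for y r
  proof -
    have "((\<lambda>r. u (y + r *\<^sub>R a)) has_derivative (\<lambda>h. U (y + r *\<^sub>R a) (h *\<^sub>R a))) (at r)"
      by (rule has_derivative_compose[of "\<lambda>r. y + r *\<^sub>R a" "\<lambda>h. h *\<^sub>R a" r UNIV u, OF _ u])
        (auto intro!: derivative_eq_intros)
    moreover have "(\<lambda>h. U (y + r *\<^sub>R a) (h *\<^sub>R a)) = (\<lambda>h. h * U (y + r *\<^sub>R a) a)"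
      using has_derivative_bounded_linear[OF u] by (auto simp: linear_simps)
    ultimately show ?thesis by (simp add: has_field_derivative_def mult.commute[of _ "U _ _"])
  qed
  have dv: "((\<lambda>r. U (y + r *\<^sub>R b) a) has_real_derivative V (y + r *\<^sub>R b) b) (at r)" for y r
  proof -
    have "((\<lambda>r. U (y + r *\<^sub>R b) a) has_derivative (\<lambda>h. V (y + r *\<^sub>R b) (h *\<^sub>R b))) (at r)"
      by (rule has_derivative_compose[of "\<lambda>r. y + r *\<^sub>R b" "\<lambda>h. h *\<^sub>R b" r UNIV "\<lambda>x. U x a", OF _ v])
        (auto intro!: derivative_eq_intros)
    moreover have "(\<lambda>h. V (y + r *\<^sub>R b) (h *\<^sub>R b)) = (\<lambda>h. h * V (y + r *\<^sub>R b) b)"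
      using has_derivative_bounded_linear[OF v] by (auto simp: linear_simps)
    ultimately show ?thesis by (simp add: has_field_derivative_def mult.commute[of _ "V _ _"])
  qed
  define g where "g r = u ((x + t *\<^sub>R b) + r *\<^sub>R a) - u (x + r *\<^sub>R a)" for r
  have "(g has_real_derivative (U ((x + t *\<^sub>R b) + r *\<^sub>R a) a - U (x + r *\<^sub>R a) a)) (at r)" for r
    unfolding g_def by (intro DERIV_diff du)
  from MVT2[OF \<open>0 < s\<close>, of g, OF this]
  obtain \<xi> where \<xi>: "0 < \<xi>" "\<xi> < s"
    "g s - g 0 = s * (U ((x + t *\<^sub>R b) + \<xi> *\<^sub>R a) a - U (x + \<xi> *\<^sub>R a) a)" by auto
  from MVT2[OF \<open>0 < t\<close>, of "\<lambda>r. U ((x + \<xi> *\<^sub>R a) + r *\<^sub>R b) a", OF dv]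
  obtain \<eta> where \<eta>: "0 < \<eta>" "\<eta> < t"
    "U ((x + \<xi> *\<^sub>R a) + t *\<^sub>R b) a - U (x + \<xi> *\<^sub>R a) a = t * V (x + \<xi> *\<^sub>R a + \<eta> *\<^sub>R b) b"
    by auto
  have "g s - g 0 = s * t * V (x + \<xi> *\<^sub>R a + \<eta> *\<^sub>R b) b"
    using \<xi>(3) \<eta>(3) by (simp add: algebra_simps)
  then show ?thesis
    using that[OF \<xi>(1,2) \<eta>(1,2)] by (simp add: g_def algebra_simps)
qed

text \<open>The second difference of \<open>u\<close> is symmetric in \<open>a\<close> and \<open>b\<close>,
  so the mean values of both mixed derivatives agree on arbitrarily small parallelograms at
  \<open>x\<close>; continuity carries this over to \<open>x\<close> itself.\<close>

lemma second_derivative_symmetric: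
  fixes u :: "'a::real_normed_vector \<Rightarrow> real"
  assumes u: "\<And>x. (u has_derivative U x) (at x)"
    and v: "\<And>x. ((\<lambda>x. U x a) has_derivative V x) (at x)"
    and w: "\<And>x. ((\<lambda>x. U x b) has_derivative W x) (at x)"
    and cont: "isCont (\<lambda>x. V x b) x" "isCont (\<lambda>x. W x a) x"
  shows "V x b = W x a"
proof (rule ccontr)
  assume "V x b \<noteq> W x a"
  define e where "e = dist (V x b) (W x a) / 2"
  have "e > 0" using \<open>V x b \<noteq> W x a\<close> by (simp add: e_def)
  obtain d1 where d1: "d1 > 0" "\<And>y. dist y x < d1 \<Longrightarrow> dist (V y b) (V x b) < e"
    using cont(1) \<open>e > 0\<close> unfolding continuous_at_eps_delta by blast
  obtain d2 where d2: "d2 > 0" "\<And>y. dist y x < d2 \<Longrightarrow> dist (W y a) (W x a) < e"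
    using cont(2) \<open>e > 0\<close> unfolding continuous_at_eps_delta by blast
  \<comment> \<open>Parallelograms at \<open>x\<close> with sides \<open>r a\<close> and \<open>r b\<close> stay in both neighbourhoods.\<close>
  define r where "r = min d1 d2 / (norm a + norm b + 1)"
  have pos: "norm a + norm b + 1 > 0"
    using norm_ge_zero[of a] norm_ge_zero[of b] by linarith
  have r: "r > 0" using d1(1) d2(1) pos by (simp add: r_def)
  have near: "dist (x + \<xi> *\<^sub>R a + \<eta> *\<^sub>R b) x < min d1 d2"
    if "0 < \<xi>" "\<xi> < r" "0 < \<eta>" "\<eta> < r" for \<xi> \<eta>
  proof -
    have "dist (x + \<xi> *\<^sub>R a + \<eta> *\<^sub>R b) x = norm (\<xi> *\<^sub>R a + \<eta> *\<^sub>R b)"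
      by (simp add: dist_norm algebra_simps)
    also have "\<dots> \<le> \<xi> * norm a + \<eta> * norm b"
      using that norm_triangle_ineq[of "\<xi> *\<^sub>R a" "\<eta> *\<^sub>R b"] by simp
    also have "\<dots> \<le> r * norm a + r * norm b"
      using that by (intro add_mono mult_right_mono) auto
    also have "\<dots> < r * (norm a + norm b + 1)" using r by (simp add: algebra_simps)
    also have "\<dots> = min d1 d2" using pos by (simp add: r_def)
    finally show ?thesis .
  qed
  obtain \<xi> \<eta> where 1: "0 < \<xi>" "\<xi> < r" "0 < \<eta>" "\<eta> < r"
    "u (x + r *\<^sub>R a + r *\<^sub>R b) - u (x + r *\<^sub>R a) - u (x + r *\<^sub>R b) + u x
      = r * r * V (x + \<xi> *\<^sub>R a + \<eta> *\<^sub>R b) b"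
    using second_difference_mean_value[OF u v r r] by metis
  obtain \<xi>' \<eta>' where 2: "0 < \<xi>'" "\<xi>' < r" "0 < \<eta>'" "\<eta>' < r"
    "u (x + r *\<^sub>R b + r *\<^sub>R a) - u (x + r *\<^sub>R b) - u (x + r *\<^sub>R a) + u x
      = r * r * W (x + \<xi>' *\<^sub>R b + \<eta>' *\<^sub>R a) a"
    using second_difference_mean_value[OF u w r r] by metis
  have "r * r * V (x + \<xi> *\<^sub>R a + \<eta> *\<^sub>R b) b = r * r * W (x + \<xi>' *\<^sub>R b + \<eta>' *\<^sub>R a) a"
    using 1(5) 2(5) by (simp add: algebra_simps)
  then have eq: "V (x + \<xi> *\<^sub>R a + \<eta> *\<^sub>R b) b = W (x + \<eta>' *\<^sub>R a + \<xi>' *\<^sub>R b) a"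
    using r by (simp add: algebra_simps)
  have "dist (V (x + \<xi> *\<^sub>R a + \<eta> *\<^sub>R b) b) (V x b) < e"
    using d1(2) near[OF 1(1-4)] by simp
  moreover have "dist (W (x + \<eta>' *\<^sub>R a + \<xi>' *\<^sub>R b) a) (W x a) < e"
    using d2(2) near[OF 2(3,4,1,2)] by simp
  ultimately have "dist (V x b) (W x a) < e + e"
    unfolding eq by (metis add_strict_mono dist_commute dist_triangle le_less_trans)
  then show False by (simp add: e_def)
qed

text \<open>The mean value theorem is for real functions, hence the detour over the real and the imaginary
  part.\<close>

lemma partial_deriv_commute:
  assumes f: "smooth f"
  shows "partial_deriv j (partial_deriv k f) = partial_deriv k (partial_deriv j f)"
proof
  fix x
  have main: "L (partial_deriv j (partial_deriv k f) x) = L (partial_deriv k (partial_deriv j f) x)"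
    if L: "bounded_linear L" for L :: "complex \<Rightarrow> real"
  proof -
    let ?F = "\<lambda>f x. frechet_derivative f (at x)"
    note D = bounded_linear.has_derivative[OF L smooth_has_derivative]
    have cont: "isCont (\<lambda>x. L (g x)) y" if "smooth g" for g y
      using D[OF that] has_derivative_continuous by blast
    show ?thesis
      using second_derivative_symmetric[of "\<lambda>x. L (f x)" "\<lambda>x h. L (?F f x h)" "axis k 1"
        "\<lambda>x h. L (?F (partial_deriv k f) x h)" "axis j 1" "\<lambda>x h. L (?F (partial_deriv j f) x h)" x]
        D[OF f] D[OF smooth_partial_deriv[OF f, of k]] D[OF smooth_partial_deriv[OF f, of j]]
        cont[OF smooth_partial_deriv[OF smooth_partial_deriv[OF f, of k], of j]]
        cont[OF smooth_partial_deriv[OF smooth_partial_deriv[OF f, of j], of k]]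
      by (simp add: partial_deriv_def)
  qed
  show "partial_deriv j (partial_deriv k f) x = partial_deriv k (partial_deriv j f) x"
    using main[OF bounded_linear_Re] main[OF bounded_linear_Im] by (rule complex_eqI)
qed

lemma iter_partial_deriv_move_front:
  assumes "smooth f"
  shows "iter_partial_deriv (us @ j # vs) f = iter_partial_deriv (j # us @ vs) f"
proof (induction us)
  case (Cons k us)
  have "iter_partial_deriv ((k # us) @ j # vs) f
      = partial_deriv k (partial_deriv j (iter_partial_deriv (us @ vs) f))"
    using Cons by simp
  also have "\<dots> = partial_deriv j (partial_deriv k (iter_partial_deriv (us @ vs) f))"
    by (rule partial_deriv_commute[OF smooth_iter_partial_deriv[OF assms]])
  finally show ?case by simp
qed simp

lemma iter_partial_deriv_cong_mset:
  assumes "smooth f" "mset js = mset ks"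
  shows "iter_partial_deriv js f = iter_partial_deriv ks f"
  using assms(2)
proof (induction js arbitrary: ks)
  case (Cons j js)
  then have "j \<in> set ks" by (metis list.set_intros(1) mset_eq_setD)
  then obtain us vs where ks: "ks = us @ j # vs" by (metis split_list)
  with Cons have "iter_partial_deriv js f = iter_partial_deriv (us @ vs) f" by simp
  then show ?case by (simp add: ks iter_partial_deriv_move_front[OF assms(1)])
qed simp

text \<open>Every multi-index is the vector of multiplicities of some list, so the choice operator in
  \<open>mi_partial\<close> picks a list with the intended multiplicities.\<close>

lemma mi_partial_conv:
  obtains js where "mi_partial \<beta> = iter_partial_deriv js" "\<And>j. count_list js j = \<beta> j"
proof -
  have "finite {j. 0 < \<beta> j}" by simp
  then obtain js where "mset js = Abs_multiset \<beta>" using ex_mset by blast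
  then have "\<forall>j. count_list js j = \<beta> j"
    using \<open>finite {j. 0 < \<beta> j}\<close> by (metis count_mset count_Abs_multiset)
  then have "\<forall>j. count_list (SOME js. \<forall>j. count_list js j = \<beta> j) j = \<beta> j"
    by (rule someI)
  then show ?thesis by (intro that) (auto simp: mi_partial_def)
qed

text \<open>The norms only see one order of differentiation for each multi-index, whereas the recursion for
  \<open>e\<^sup>i\<^sup>q f\<close> produces derivatives of \<open>f\<close> in any order.\<close>

lemma iter_partial_deriv_eq_mi_partial:
  assumes "smooth f"
  shows "iter_partial_deriv js f = mi_partial (count_list js) f"
proof -
  obtain ks where ks: "mi_partial (count_list js) = iter_partial_deriv ks"
    "\<And>j. count_list ks j = count_list js j"
    using mi_partial_conv[of "count_list js"] by metis
  have "mset js = mset ks" by (rule multiset_eqI) (simp add: ks(2) count_mset)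
  then show ?thesis unfolding ks(1) by (rule iter_partial_deriv_cong_mset[OF assms])
qed

lemma mi_abs_count_list: "mi_abs (count_list js) = length js"
proof (induction js)
  case (Cons j js)
  have "count_list (j # js) = (\<lambda>i. count_list js i + (if i = j then 1 else 0))" by auto
  then have "mi_abs (count_list (j # js)) = mi_abs (count_list js) + 1"
    unfolding mi_abs_def by (simp only: sum.distrib) simp
  then show ?case using Cons by (simp del: count_list.simps)
qed (simp add: mi_abs_def)

section \<open>Products, monomials and exponentials of smooth functions\<close>

lemma partial_deriv_mult:
  assumes "smooth f" "smooth g"
  shows "partial_deriv j (\<lambda>x. f x * g x) = (\<lambda>x. partial_deriv j f x * g x + f x * partial_deriv j g x)"
proof
  fix x
  show "partial_deriv j (\<lambda>x. f x * g x) x = partial_deriv j f x * g x + f x * partial_deriv j g x"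
    using partial_deriv_eqI[OF has_derivative_mult[OF smooth_has_derivative[OF assms(1)] smooth_has_derivative[OF assms(2)]], of j x]
    by (simp add: partial_deriv_def)
qed

text \<open>Products of smooth functions alone are not closed under differentiation, because of the product
  rule; their sums are.\<close>

inductive_set product_span :: "(real^'n::finite \<Rightarrow> complex) set" where
  mult: "smooth f \<Longrightarrow> smooth g \<Longrightarrow> (\<lambda>x. f x * g x) \<in> product_span"
| add: "u \<in> product_span \<Longrightarrow> v \<in> product_span \<Longrightarrow> (\<lambda>x. u x + v x) \<in> product_span"

lemma product_span_props:
  assumes "u \<in> product_span"
  shows "(\<forall>x. u differentiable (at x)) \<and> (\<forall>j. partial_deriv j u \<in> product_span)"
  using assms
proof induction
  case (mult f g)
  have "(\<lambda>x. f x * g x) differentiable (at x)" for x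
    using smooth_has_derivative[OF mult(1)] smooth_has_derivative[OF mult(2)]
    by (intro differentiable_mult) (auto simp: differentiable_def)
  then show ?case
    by (auto simp: partial_deriv_mult mult intro!: product_span.intros smooth_partial_deriv)
next
  case (add u v)
  have "partial_deriv j (\<lambda>x. u x + v x) = (\<lambda>x. partial_deriv j u x + partial_deriv j v x)" for j
  proof
    fix x
    show "partial_deriv j (\<lambda>x. u x + v x) x = partial_deriv j u x + partial_deriv j v x"
      using add partial_deriv_eqI[OF has_derivative_add, of u "frechet_derivative u (at x)" x v
        "frechet_derivative v (at x)" j]
      by (simp add: frechet_derivative_works[symmetric]) (simp add: partial_deriv_def)
  qed
  then show ?case using add by (auto intro!: product_span.intros differentiable_add)
qed

lemma smooth_mult: "smooth f \<Longrightarrow> smooth g \<Longrightarrow> smooth (\<lambda>x. f x * g x)"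
  by (rule smoothI_closed[of _ product_span]) (auto simp: product_span_props intro: product_span.mult)

lemma partial_deriv_const: "partial_deriv j (\<lambda>x. c) = (\<lambda>x. 0)"
  by (auto simp: partial_deriv_def)

lemma smooth_const: "smooth (\<lambda>x. c)"
  by (rule smoothI_closed[of _ "range (\<lambda>c x. c)"]) (auto simp: partial_deriv_const)

lemma smooth_sum: "(\<And>i. i \<in> I \<Longrightarrow> smooth (f i)) \<Longrightarrow> smooth (\<lambda>x. \<Sum>i\<in>I. f i x)"
proof (induction I rule: infinite_finite_induct)
  case (insert i I)
  then show ?case using smooth_lin[of "f i" "\<lambda>x. \<Sum>i\<in>I. f i x" 1 1] by simp
qed (auto simp: smooth_const)

lemma iter_partial_deriv_sum:
  assumes "\<And>i. i \<in> I \<Longrightarrow> smooth (f i)"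
  shows "iter_partial_deriv js (\<lambda>x. \<Sum>i\<in>I. c i * f i x) = (\<lambda>x. \<Sum>i\<in>I. c i * iter_partial_deriv js (f i) x)"
  using assms
proof (induction I rule: infinite_finite_induct)
  case (insert i I)
  have s: "smooth (\<lambda>x. \<Sum>i\<in>I. c i * f i x)"
    by (intro smooth_sum smooth_mult smooth_const insert) auto
  show ?case using insert iter_partial_deriv_lin[OF _ s, of "f i" js "c i" 1] by simp
qed (auto simp: iter_partial_deriv_zero)

lemma smooth_add: "smooth f \<Longrightarrow> smooth g \<Longrightarrow> smooth (\<lambda>x. f x + g x)"
  using smooth_lin[of f g 1 1] by simp

lemma iter_partial_deriv_add:
  "smooth f \<Longrightarrow> smooth g \<Longrightarrow>
    iter_partial_deriv js (\<lambda>x. f x + g x) = (\<lambda>x. iter_partial_deriv js f x + iter_partial_deriv js g x)"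
  using iter_partial_deriv_lin[of f g js 1 1] by simp

lemma iter_partial_deriv_cmult:
  "smooth f \<Longrightarrow> iter_partial_deriv js (\<lambda>x. a * f x) = (\<lambda>x. a * iter_partial_deriv js f x)"
  using iter_partial_deriv_lin[of f f js a 0] by simp


lemma smooth_coordinate: "smooth (\<lambda>x::real^'n::finite. complex_of_real (x $ i))"
proof (rule smoothI_closed[of _ "insert (\<lambda>x. complex_of_real (x $ i)) (range (\<lambda>c x. c))"])
  have d: "((\<lambda>x. complex_of_real (x $ i)) has_derivative (\<lambda>h. complex_of_real (h $ i))) (at x)" for x :: "real^'n"
    by (auto intro!: derivative_eq_intros bounded_linear.has_derivative[OF bounded_linear_vec_nth])
  then show "g differentiable (at x)"
    if "g \<in> insert (\<lambda>x. complex_of_real (x $ i)) (range (\<lambda>c x. c))" for g and x :: "real^'n"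
    using that differentiableI by auto
  have "partial_deriv j (\<lambda>x. complex_of_real (x $ i)) = (\<lambda>x. complex_of_real (axis j 1 $ i))" for j :: 'n
    using partial_deriv_eqI[OF d] by blast
  then show "partial_deriv j g \<in> insert (\<lambda>x. complex_of_real (x $ i)) (range (\<lambda>c x. c))"
    if "g \<in> insert (\<lambda>x. complex_of_real (x $ i)) (range (\<lambda>c x. c))" for g and j :: 'n
    using that by (auto simp: partial_deriv_const)
qed simp

lemma smooth_power: "smooth f \<Longrightarrow> smooth (\<lambda>x. f x ^ k)"
  by (induction k) (auto intro: smooth_mult smooth_const)

lemma smooth_prod: "(\<And>i. i \<in> I \<Longrightarrow> smooth (f i)) \<Longrightarrow> smooth (\<lambda>x. \<Prod>i\<in>I. f i x)"
  by (induction I rule: infinite_finite_induct) (auto intro: smooth_mult smooth_const)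

lemma smooth_mi_power: "smooth (\<lambda>x. complex_of_real (mi_power x \<mu>))"
  unfolding mi_power_def by (simp add: smooth_prod smooth_power smooth_coordinate)

lemma partial_deriv_mi_power:
  fixes x :: "real^'n::finite"
  shows "partial_deriv j (\<lambda>x. complex_of_real (mi_power x \<mu>)) x
     = of_nat (\<mu> j) * complex_of_real (mi_power x (\<mu>(j := \<mu> j - 1)))"
proof -
  have co: "((\<lambda>x::real^'n. x $ i) has_derivative (\<lambda>h. h $ i)) (at x)" for i
    by (rule bounded_linear_imp_has_derivative[OF bounded_linear_vec_nth])
  have "((\<lambda>x::real^'n. \<Prod>i\<in>UNIV. (x $ i) ^ \<mu> i) has_derivative
     (\<lambda>h. \<Sum>i\<in>UNIV. (of_nat (\<mu> i) * h $ i * (x $ i) ^ (\<mu> i - 1)) * (\<Prod>k\<in>UNIV - {i}. (x $ k) ^ \<mu> k))) (at x)"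
    by (rule has_derivative_prod) (use has_derivative_power[OF co] in simp)
  then have "((\<lambda>x::real^'n. complex_of_real (mi_power x \<mu>)) has_derivative
     (\<lambda>h. complex_of_real (\<Sum>i\<in>UNIV. (of_nat (\<mu> i) * h $ i * (x $ i) ^ (\<mu> i - 1)) * (\<Prod>k\<in>UNIV - {i}. (x $ k) ^ \<mu> k)))) (at x)"
    unfolding mi_power_def by (rule has_derivative_of_real)
  then have "partial_deriv j (\<lambda>x. complex_of_real (mi_power x \<mu>)) x
     = complex_of_real (\<Sum>i\<in>UNIV. (of_nat (\<mu> i) * (axis j 1 :: real^'n) $ i * (x $ i) ^ (\<mu> i - 1)) * (\<Prod>k\<in>UNIV - {i}. (x $ k) ^ \<mu> k))"
    by (rule partial_deriv_eqI)
  also have "(\<Sum>i\<in>UNIV. (of_nat (\<mu> i) * (axis j 1 :: real^'n) $ i * (x $ i) ^ (\<mu> i - 1)) * (\<Prod>k\<in>UNIV - {i}. (x $ k) ^ \<mu> k))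
     = (\<Sum>i\<in>UNIV. if i = j then of_nat (\<mu> j) * (x $ j) ^ (\<mu> j - 1) * (\<Prod>k\<in>UNIV - {j}. (x $ k) ^ \<mu> k) else 0)"
    by (intro sum.cong) (auto simp: axis_def)
  also have "\<dots> = of_nat (\<mu> j) * mi_power x (\<mu>(j := \<mu> j - 1))"
    unfolding mi_power_def by (subst (2) prod.remove[of _ j]) (auto intro!: prod.cong)
  finally show ?thesis by simp
qed

lemma partial_deriv_exp:
  fixes q :: "real^'n::finite \<Rightarrow> complex"
  assumes "smooth q" "smooth p"
  shows "(\<lambda>x. exp (q x) * p x) differentiable (at x)"
    and "partial_deriv j (\<lambda>x. exp (q x) * p x) x
      = exp (q x) * (partial_deriv j q x * p x + partial_deriv j p x)"
proof -
  have e: "((\<lambda>x. exp (q x)) has_derivative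
    (\<lambda>h. exp (q x) * frechet_derivative q (at x) h)) (at x)"
    using has_derivative_compose[OF smooth_has_derivative[OF assms(1)], of exp "(*) (exp (q x))"]
    using DERIV_exp[of "q x"] by (simp add: has_field_derivative_def)
  have d: "((\<lambda>x. exp (q x) * p x) has_derivative
    (\<lambda>h. exp (q x) * frechet_derivative p (at x) h + (exp (q x) * frechet_derivative q (at x) h) * p x)) (at x)"
    by (rule has_derivative_mult[OF e smooth_has_derivative[OF assms(2)]])
  show "(\<lambda>x. exp (q x) * p x) differentiable (at x)" using d by (auto simp: differentiable_def)
  show "partial_deriv j (\<lambda>x. exp (q x) * p x) x
      = exp (q x) * (partial_deriv j q x * p x + partial_deriv j p x)"
    using partial_deriv_eqI[OF d] by (simp add: partial_deriv_def algebra_simps)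
qed

lemma smooth_exp_mult:
  fixes q :: "real^'n::finite \<Rightarrow> complex"
  assumes "smooth q" "smooth p"
  shows "smooth (\<lambda>x. exp (q x) * p x)"
proof (rule smoothI_closed[of _ "{\<lambda>x. exp (q x) * r x | r. smooth r}"], goal_cases)
  case 1
  show ?case using assms(2) by blast
next
  case (2 g x)
  then show ?case using partial_deriv_exp(1)[OF assms(1)] by blast
next
  case (3 g j)
  then obtain r where r: "smooth r" "g = (\<lambda>x. exp (q x) * r x)" by blast
  have "smooth (\<lambda>x. partial_deriv j q x * r x + partial_deriv j r x)"
    using smooth_lin[OF smooth_mult[OF smooth_partial_deriv[OF assms(1)] r(1)]
        smooth_partial_deriv[OF r(1)], where a = 1 and b = 1] by simp
  moreover have "partial_deriv j g = (\<lambda>x. exp (q x) * (partial_deriv j q x * r x + partial_deriv j r x))"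
    unfolding r(2) using partial_deriv_exp(2)[OF assms(1) r(1)] by blast
  ultimately show ?case
    by (auto intro!: exI[of _ "\<lambda>x. partial_deriv j q x * r x + partial_deriv j r x"])
qed


section \<open>Iterated derivatives of the modulated function\<close>

lemma mi_power_add: "mi_power x (\<lambda>i. \<mu> i + \<nu> i) = mi_power x \<mu> * mi_power x \<nu>"
  by (simp add: mi_power_def power_add prod.distrib)

lemma mi_abs_add: "mi_abs (\<lambda>i. \<mu> i + \<nu> i) = mi_abs \<mu> + mi_abs \<nu>"
  by (simp add: mi_abs_def sum.distrib)

lemma mi_abs_decr:
  assumes "\<mu> j \<noteq> 0"
  shows "mi_abs (\<mu>(j := \<mu> j - 1)) + 1 = mi_abs \<mu>"
proof -
  have "mi_abs \<mu> = \<mu> j + (\<Sum>i\<in>UNIV - {j}. \<mu> i)"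
    unfolding mi_abs_def by (rule sum.remove) auto
  moreover have "mi_abs (\<mu>(j := \<mu> j - 1)) = (\<mu> j - 1) + (\<Sum>i\<in>UNIV - {j}. \<mu> i)"
    unfolding mi_abs_def by (subst sum.remove[of _ j]) (auto intro!: sum.cong)
  ultimately show ?thesis using assms by simp
qed

lemma mi_le_abs: "\<mu> j \<le> mi_abs \<mu>"
  unfolding mi_abs_def by (rule member_le_sum) auto

text \<open>The family \<open>e\<^sup>p x\<^sup>\<mu> \<partial>\<^sub>l\<^sub>s f\<close>: for a polynomial
  \<open>p\<close>, its linear combinations are closed under differentiation.\<close>

definition exp_term ::
    "(real^'n::finite \<Rightarrow> complex) \<Rightarrow> (real^'n \<Rightarrow> complex) \<Rightarrow> 'n mindex \<Rightarrow> 'n list \<Rightarrow> real^'n \<Rightarrow> complex"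
  where "exp_term p f \<mu> ls x =
    exp (p x) * (complex_of_real (mi_power x \<mu>) * iter_partial_deriv ls f x)"

lemma smooth_exp_term: "smooth p \<Longrightarrow> smooth f \<Longrightarrow> smooth (exp_term p f \<mu> ls)"
  unfolding exp_term_def
  by (intro smooth_exp_mult smooth_mult smooth_mi_power smooth_iter_partial_deriv)

text \<open>The function \<open>i q\<close> for the polynomial \<open>q\<close> with coefficients
  \<open>c\<close>.\<close>

definition phase :: "('n::finite mindex \<Rightarrow> real) \<Rightarrow> 'n mindex set \<Rightarrow> real^'n \<Rightarrow> complex"
  where "phase c S x = (\<Sum>\<alpha>\<in>S. (\<i> * complex_of_real (c \<alpha>)) * complex_of_real (mi_power x \<alpha>))"

lemma smooth_phase: "smooth (phase c S)"
  unfolding phase_def by (intro smooth_sum smooth_mult smooth_const smooth_mi_power)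

lemma partial_deriv_phase:
  "partial_deriv j (phase c S) x
    = (\<Sum>\<alpha>\<in>S. (\<i> * complex_of_real (c \<alpha>)) * (of_nat (\<alpha> j) * complex_of_real (mi_power x (\<alpha>(j := \<alpha> j - 1)))))"
  using iter_partial_deriv_sum[of S "\<lambda>\<alpha> x. complex_of_real (mi_power x \<alpha>)" "[j]" "\<lambda>\<alpha>. \<i> * complex_of_real (c \<alpha>)"]
  by (simp add: phase_def[abs_def] smooth_mi_power partial_deriv_mi_power)

text \<open>The product rule: the derivative falls on the exponential, on the monomial, or on
  \<open>f\<close>.  Truncated subtraction in \<open>\<mu> j - 1\<close> is harmless, since the
  coefficient vanishes when \<open>\<mu> j = 0\<close>, and likewise for \<open>\<alpha> j\<close>.\<close>

lemma partial_deriv_exp_term: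
  assumes "smooth f"
  shows "partial_deriv j (exp_term (phase c S) f \<mu> ls) = (\<lambda>x.
     (\<Sum>\<alpha>\<in>S. (\<i> * complex_of_real (c \<alpha>) * of_nat (\<alpha> j)) *
            exp_term (phase c S) f (\<lambda>i. (\<alpha>(j := \<alpha> j - 1)) i + \<mu> i) ls x)
     + (of_nat (\<mu> j) * exp_term (phase c S) f (\<mu>(j := \<mu> j - 1)) ls x
            + exp_term (phase c S) f \<mu> (j # ls) x))"
proof
  fix x
  have "partial_deriv j (exp_term (phase c S) f \<mu> ls) x = exp (phase c S x) *
     (partial_deriv j (phase c S) x * (complex_of_real (mi_power x \<mu>) * iter_partial_deriv ls f x)
      + (of_nat (\<mu> j) * complex_of_real (mi_power x (\<mu>(j := \<mu> j - 1))) * iter_partial_deriv ls f x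
        + complex_of_real (mi_power x \<mu>) * iter_partial_deriv (j # ls) f x))"
    unfolding exp_term_def
    by (subst partial_deriv_exp(2))
      (simp_all add: smooth_phase smooth_mult smooth_mi_power smooth_iter_partial_deriv assms
        partial_deriv_mult partial_deriv_mi_power)
  then show "partial_deriv j (exp_term (phase c S) f \<mu> ls) x =
     (\<Sum>\<alpha>\<in>S. (\<i> * complex_of_real (c \<alpha>) * of_nat (\<alpha> j)) *
            exp_term (phase c S) f (\<lambda>i. (\<alpha>(j := \<alpha> j - 1)) i + \<mu> i) ls x)
     + (of_nat (\<mu> j) * exp_term (phase c S) f (\<mu>(j := \<mu> j - 1)) ls x
            + exp_term (phase c S) f \<mu> (j # ls) x)"
    by (simp add: partial_deriv_phase exp_term_def mi_power_add distrib_left sum_distrib_left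
        sum_distrib_right mult_ac del: fun_upd_apply)
qed

text \<open>The weight \<open>\<sigma> ^ \<bar>\<mu>\<bar> \<tau> ^ length ls\<close> dominates the member
  of the family with indices \<open>\<mu>\<close> and \<open>ls\<close>, and by
  \<open>partial_deriv_exp_term\<close> one derivative multiplies it by at most
  \<open>\<Lambda>\<close>: the three summands of \<open>\<Lambda>\<close> belong to the
  exponential, the monomial and \<open>f\<close>.  The weights are only required up to degree
  \<open>P\<close> and order \<open>n\<close>, and the last two hypotheses say that the
  derivatives in \<open>js\<close> cannot lead beyond.  The induction removes the innermost
  derivative, to which the product rule applies.\<close>

lemma iter_partial_deriv_exp_term_bound:
  fixes f :: "real^'n::finite \<Rightarrow> complex" and c :: "'n mindex \<Rightarrow> real" and P m n :: nat
  assumes f: "smooth f" and deg: "\<And>\<alpha>. \<alpha> \<in> S \<Longrightarrow> mi_abs \<alpha> \<le> m"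
    and \<sigma>: "\<sigma> \<ge> 1" and \<tau>: "\<tau> \<ge> 0" and D: "D \<ge> 0"
    and base: "\<And>\<mu> ls. mi_abs \<mu> \<le> P \<Longrightarrow> length ls \<le> n \<Longrightarrow>
      \<bar>mi_power x \<mu>\<bar> * cmod (iter_partial_deriv ls f x) \<le> D * \<sigma> ^ mi_abs \<mu> * \<tau> ^ length ls"
  defines "\<Lambda> \<equiv> real m * (\<Sum>\<alpha>\<in>S. \<bar>c \<alpha>\<bar>) * \<sigma> ^ (m - 1) + real P / \<sigma> + \<tau>"
  assumes "mi_abs \<mu> + (m - 1) * length js \<le> P" "length ls + length js \<le> n"
  shows "cmod (iter_partial_deriv js (exp_term (phase c S) f \<mu> ls) x)
    \<le> D * \<Lambda> ^ length js * \<sigma> ^ mi_abs \<mu> * \<tau> ^ length ls"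
  using assms(8,9)
proof (induction js arbitrary: \<mu> ls rule: rev_induct)
  case Nil
  have "Re (phase c S x) = 0" by (simp add: phase_def)
  then have "cmod (exp (phase c S x)) = 1" by simp
  then show ?case using base[of \<mu> ls] Nil by (simp add: exp_term_def norm_mult)
next
  case (snoc j js)
  define E where "E = exp_term (phase c S) f"
  define k where "k = length js"
  define w where "w = D * \<Lambda> ^ k * \<sigma> ^ mi_abs \<mu> * \<tau> ^ length ls"
  have sE: "smooth (E \<mu> ls)" for \<mu> ls
    unfolding E_def by (rule smooth_exp_term[OF smooth_phase f])
  have \<Lambda>: "\<Lambda> \<ge> 0" using \<sigma> \<tau> unfolding \<Lambda>_def
    by (intro add_nonneg_nonneg mult_nonneg_nonneg sum_nonneg) auto
  have w: "w \<ge> 0" using \<Lambda> D \<sigma> \<tau> by (simp add: w_def)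
  have IH: "cmod (iter_partial_deriv js (E \<nu> ks) x) \<le> D * \<Lambda> ^ k * \<sigma> ^ mi_abs \<nu> * \<tau> ^ length ks"
    if "mi_abs \<nu> + (m - 1) * k \<le> P" "length ks + k \<le> n" for \<nu> ks
    using snoc.IH[of \<nu> ks] that by (simp add: E_def k_def)
  have le: "mi_abs \<mu> + (m - 1) * k + (m - 1) \<le> P" "length ls + k + 1 \<le> n"
    using snoc.prems by (simp_all add: k_def add_ac)
  \<comment> \<open>The monomials of \<open>\<partial>\<^sub>j q\<close> have degree at most \<open>m - 1\<close>, and \<open>\<sigma> \<ge> 1\<close> allows that degree for all.\<close>
  have one: "cmod (iter_partial_deriv js (E (\<lambda>i. (\<alpha>(j := \<alpha> j - 1)) i + \<mu> i) ls) x) * real (\<alpha> j)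
      \<le> w * \<sigma> ^ (m - 1) * real m" if "\<alpha> \<in> S" for \<alpha>
  proof (cases "\<alpha> j = 0")
    case False
    let ?\<nu> = "\<lambda>i. (\<alpha>(j := \<alpha> j - 1)) i + \<mu> i"
    have \<nu>: "mi_abs ?\<nu> \<le> mi_abs \<mu> + (m - 1)"
      using mi_abs_decr[of \<alpha> j, OF False] deg[OF that] unfolding mi_abs_add by linarith
    have "cmod (iter_partial_deriv js (E ?\<nu> ls) x) \<le> D * \<Lambda> ^ k * \<sigma> ^ mi_abs ?\<nu> * \<tau> ^ length ls"
      using \<nu> le by (intro IH) linarith+
    also have "\<dots> \<le> D * \<Lambda> ^ k * \<sigma> ^ (mi_abs \<mu> + (m - 1)) * \<tau> ^ length ls"
      using \<nu> D \<Lambda> \<sigma> \<tau> by (intro mult_right_mono mult_left_mono power_increasing) auto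
    also have "\<dots> = w * \<sigma> ^ (m - 1)" by (simp add: w_def power_add)
    finally show ?thesis
      using mi_le_abs[of \<alpha> j] deg[OF that] w \<sigma> by (intro mult_mono) auto
  qed (use w \<sigma> in simp)
  have two: "real (\<mu> j) * cmod (iter_partial_deriv js (E (\<mu>(j := \<mu> j - 1)) ls) x) \<le> w * (real P / \<sigma>)"
  proof (cases "\<mu> j = 0")
    case False
    let ?\<nu> = "\<mu>(j := \<mu> j - 1)"
    have \<nu>: "mi_abs ?\<nu> + 1 = mi_abs \<mu>" using mi_abs_decr[of \<mu> j, OF False] .
    have "cmod (iter_partial_deriv js (E ?\<nu> ls) x) \<le> D * \<Lambda> ^ k * \<sigma> ^ mi_abs ?\<nu> * \<tau> ^ length ls"
      using \<nu> le by (intro IH) linarith+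
    also have "\<dots> = w / \<sigma>" using \<sigma> by (simp add: w_def flip: \<nu>)
    finally have "cmod (iter_partial_deriv js (E ?\<nu> ls) x) \<le> w / \<sigma>" .
    moreover have "\<mu> j \<le> P" using mi_le_abs[of \<mu> j] le by linarith
    ultimately have "real (\<mu> j) * cmod (iter_partial_deriv js (E ?\<nu> ls) x) \<le> real P * (w / \<sigma>)"
      by (intro mult_mono) auto
    then show ?thesis by (simp add: mult.commute)
  qed (use w \<sigma> in simp)
  have three: "cmod (iter_partial_deriv js (E \<mu> (j # ls)) x) \<le> w * \<tau>"
    using IH[of \<mu> "j # ls"] le by (simp add: w_def mult_ac)
  have s1: "smooth (\<lambda>x. \<Sum>\<alpha>\<in>S. (\<i> * complex_of_real (c \<alpha>) * of_nat (\<alpha> j)) *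
            E (\<lambda>i. (\<alpha>(j := \<alpha> j - 1)) i + \<mu> i) ls x)"
    by (intro smooth_sum smooth_mult smooth_const sE)
  have expand: "iter_partial_deriv (js @ [j]) (E \<mu> ls) x = (\<Sum>\<alpha>\<in>S. (\<i> * complex_of_real (c \<alpha>) * of_nat (\<alpha> j)) *
            iter_partial_deriv js (E (\<lambda>i. (\<alpha>(j := \<alpha> j - 1)) i + \<mu> i) ls) x)
       + (of_nat (\<mu> j) * iter_partial_deriv js (E (\<mu>(j := \<mu> j - 1)) ls) x
            + iter_partial_deriv js (E \<mu> (j # ls)) x)"
    unfolding iter_partial_deriv_append iter_partial_deriv.simps
      partial_deriv_exp_term[OF f, of j c S \<mu> ls, folded E_def]
      iter_partial_deriv_add[OF s1 smooth_add[OF smooth_mult[OF smooth_const sE] sE]]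
      iter_partial_deriv_add[OF smooth_mult[OF smooth_const sE] sE]
      iter_partial_deriv_cmult[OF sE] iter_partial_deriv_sum[OF sE] ..
  have "cmod (iter_partial_deriv (js @ [j]) (E \<mu> ls) x) \<le> (\<Sum>\<alpha>\<in>S. cmod ((\<i> * complex_of_real (c \<alpha>) * of_nat (\<alpha> j)) *
            iter_partial_deriv js (E (\<lambda>i. (\<alpha>(j := \<alpha> j - 1)) i + \<mu> i) ls) x))
       + (cmod (of_nat (\<mu> j) * iter_partial_deriv js (E (\<mu>(j := \<mu> j - 1)) ls) x)
            + cmod (iter_partial_deriv js (E \<mu> (j # ls)) x))"
    unfolding expand by (rule norm_triangle_mono[OF norm_sum norm_triangle_ineq])
  also have "\<dots> \<le> (\<Sum>\<alpha>\<in>S. \<bar>c \<alpha>\<bar> * (w * \<sigma> ^ (m - 1) * real m)) + (w * (real P / \<sigma>) + w * \<tau>)"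
  proof (intro add_mono sum_mono)
    fix \<alpha> assume "\<alpha> \<in> S"
    show "cmod ((\<i> * complex_of_real (c \<alpha>) * of_nat (\<alpha> j)) *
            iter_partial_deriv js (E (\<lambda>i. (\<alpha>(j := \<alpha> j - 1)) i + \<mu> i) ls) x)
        \<le> \<bar>c \<alpha>\<bar> * (w * \<sigma> ^ (m - 1) * real m)"
      using mult_left_mono[OF one[OF \<open>\<alpha> \<in> S\<close>], of "\<bar>c \<alpha>\<bar>"]
      by (simp add: norm_mult mult_ac del: fun_upd_apply)
  next
    show "cmod (of_nat (\<mu> j) * iter_partial_deriv js (E (\<mu>(j := \<mu> j - 1)) ls) x) \<le> w * (real P / \<sigma>)"
      using two by (simp add: norm_mult)
    show "cmod (iter_partial_deriv js (E \<mu> (j # ls)) x) \<le> w * \<tau>" by (rule three)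
  qed
  also have "\<dots> = w * \<Lambda>"
    unfolding \<Lambda>_def sum_distrib_right[symmetric] by (simp add: distrib_left)
  also have "\<dots> = D * \<Lambda> ^ length (js @ [j]) * \<sigma> ^ mi_abs \<mu> * \<tau> ^ length ls"
    by (simp add: w_def k_def)
  finally show ?case by (simp only: E_def)
qed


section \<open>Asymptotics of the growth factor\<close>

lemma eventually_le_imp_le_const_mult:
  fixes F G :: "nat \<Rightarrow> real"
  assumes ev: "eventually (\<lambda>n. F n \<le> G n) sequentially"
    and F: "\<And>n. F n \<ge> 0" and G: "\<And>n. G n > 0"
  obtains C where "C > 0" "\<And>n. F n \<le> C * G n"
proof -
  obtain n0 where n0: "\<And>n. n \<ge> n0 \<Longrightarrow> F n \<le> G n"
    using ev by (auto simp: eventually_sequentially)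
  define C where "C = 1 + (\<Sum>n<n0. F n / G n)"
  have C: "C \<ge> 1" unfolding C_def using F G by (auto intro!: sum_nonneg divide_nonneg_pos)
  have "F n \<le> C * G n" for n
  proof (cases "n < n0")
    case True
    have "F n / G n \<le> (\<Sum>n<n0. F n / G n)"
      using True F G by (intro member_le_sum) (auto intro!: divide_nonneg_pos)
    then have "F n / G n \<le> C" by (simp add: C_def)
    then show ?thesis using G[of n] by (simp add: pos_divide_le_eq)
  next
    case False
    then have "F n \<le> 1 * G n" using n0 by simp
    also have "\<dots> \<le> C * G n" using C G[of n] by (intro mult_right_mono) auto
    finally show ?thesis .
  qed
  then show ?thesis using that C by (metis less_le_trans zero_less_one)
qed

lemma power_self_le_exp_fact: "real n ^ n \<le> exp (real n) * fact n"
proof -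
  have "real n ^ n / fact n = (\<Sum>k\<in>{n}. real n ^ k /\<^sub>R fact k)" by (simp add: field_simps)
  also have "\<dots> \<le> exp (real n)"
    unfolding exp_def by (rule sum_le_suminf) (auto simp: summable_exp)
  finally show ?thesis by (simp add: field_simps)
qed

text \<open>This turns the geometric weight \<open>(n\<^sup>s)\<^sup>n\<close> back into the factorial
  \<open>n!\<^sup>s\<close>.\<close>

lemma powr_times_power_le:
  assumes "s \<ge> 0"
  shows "(real n powr s) ^ n \<le> exp s ^ n * fact n powr s"
proof -
  have "(real n powr s) ^ n = (real n ^ n) powr s"
  proof (cases "n = 0")
    case False
    then show ?thesis by (simp add: powr_powr powr_realpow[symmetric] mult.commute)
  qed simp
  also have "\<dots> \<le> (exp (real n) * fact n) powr s"
    using power_self_le_exp_fact assms by (intro powr_mono2) auto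
  also have "\<dots> = exp (real n) powr s * fact n powr s"
    by (rule powr_mult)
  also have "exp (real n) powr s = exp s ^ n"
    by (simp add: powr_def exp_of_nat_mult[symmetric] mult.commute)
  finally show ?thesis .
qed

text \<open>For large \<open>n\<close> the maximum in \<open>\<sigma>\<close> is its second argument and all
  three summands are bounded by multiples of \<open>(h + h ^ (m - 1)) n\<^sup>s\<close>.  How
  large \<open>n\<close> has to be depends on \<open>h\<close>, and this goes into
  \<open>C\<close>; the essential point is that \<open>K\<close> does not depend on
  \<open>h\<close>.\<close>

lemma growth_factor_bound:
  fixes s \<theta> B :: real and m :: nat
  assumes m: "m \<ge> 2" and \<theta>: "\<theta> > 0" and B: "B \<ge> 0"
    and s: "s \<ge> (real m - 1) * \<theta>" "(real m - 1) * \<theta> \<ge> 1"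
  defines "\<sigma> \<equiv> \<lambda>h n. max 1 (2 powr \<theta> * h * real ((m - 1) * n) powr \<theta>)"
  obtains K where "K > 0" "\<And>h. h > 0 \<Longrightarrow> \<exists>C>0. \<forall>n.
    (B * \<sigma> h n ^ (m - 1) + real ((m - 1) * n) / \<sigma> h n + h * real n powr s) ^ n
      \<le> C * ((K * (h + h ^ (m - 1))) ^ n * fact n powr s)"
proof -
  \<comment> \<open>For large \<open>n\<close> one has \<open>\<sigma> h n = a * h * n powr \<theta>\<close>.  In \<open>K\<close>, the summand \<open>1\<close> covers \<open>P / \<sigma>\<close>
      and \<open>h n\<^sup>s\<close>, and \<open>exp s\<close> comes from \<open>n\<^sup>n \<le> e\<^sup>n n!\<close>.\<close>
  define a where "a = 2 powr \<theta> * real (m - 1) powr \<theta>"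
  define K where "K = (B * a ^ (m - 1) + 1) * exp s"
  have a: "a > 0" using m by (simp add: a_def)
  have K: "K > 0" using a B by (simp add: K_def add_nonneg_pos)
  have "\<exists>C>0. \<forall>n. (B * \<sigma> h n ^ (m - 1) + real ((m - 1) * n) / \<sigma> h n + h * real n powr s) ^ n
      \<le> C * ((K * (h + h ^ (m - 1))) ^ n * fact n powr s)" if h: "h > 0" for h
  proof -
    define \<Lambda> where "\<Lambda> n = B * \<sigma> h n ^ (m - 1) + real ((m - 1) * n) / \<sigma> h n + h * real n powr s" for n
    have \<sigma>1: "\<sigma> h n \<ge> 1" for n by (simp add: \<sigma>_def)
    have \<Lambda>0: "\<Lambda> n \<ge> 0" for n unfolding \<Lambda>_def
      using \<sigma>1[of n] h B by (intro add_nonneg_nonneg mult_nonneg_nonneg divide_nonneg_nonneg) auto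
    \<comment> \<open>This makes the second argument of the maximum in \<open>\<sigma>\<close> the larger one.\<close>
    have "(\<lambda>n. real n powr (- \<theta>)) \<longlonglongrightarrow> 0"
      by (rule tendsto_neg_powr) (use \<theta> filterlim_real_sequentially in auto)
    then have ev1: "eventually (\<lambda>n. real n powr (- \<theta>) < a * h) sequentially"
      using a h by (auto elim!: order_tendstoD(2))
    \<comment> \<open>This is the bound \<open>h ^ (m - 1) n\<^sup>s\<close> for \<open>P / \<sigma>\<close>, since \<open>h ^ m = h * h ^ (m - 1)\<close>.\<close>
    have "(\<lambda>n. real n powr (1 - \<theta> - s)) \<longlonglongrightarrow> 0"
      by (rule tendsto_neg_powr) (use \<theta> s filterlim_real_sequentially in auto)
    then have ev2: "eventually (\<lambda>n. real n powr (1 - \<theta> - s) < a * h ^ m / real (m - 1)) sequentially"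
      using a h m by (auto elim!: order_tendstoD(2))
    have "eventually (\<lambda>n. \<Lambda> n ^ n \<le> (K * (h + h ^ (m - 1))) ^ n * fact n powr s) sequentially"
      using ev1 ev2 eventually_gt_at_top[of 0]
    proof eventually_elim
      case (elim n)
      then have n: "real n > 0" by simp
      have m': "h ^ m = h * h ^ (m - 1)" using m by (cases m) auto
      have "1 \<le> a * h * real n powr \<theta>"
        using elim(1) n by (simp add: powr_minus divide_simps)
      then have \<sigma>: "\<sigma> h n = a * h * real n powr \<theta>"
        using n by (simp add: \<sigma>_def a_def powr_mult mult_ac)
      have "\<sigma> h n ^ (m - 1) = a ^ (m - 1) * h ^ (m - 1) * real n powr ((real m - 1) * \<theta>)"
        using n m by (simp add: \<sigma> power_mult_distrib powr_realpow[symmetric] powr_powr of_nat_diff mult.commute)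
      also have "\<dots> \<le> a ^ (m - 1) * h ^ (m - 1) * real n powr s"
        using a h n elim s by (intro mult_left_mono powr_mono) auto
      finally have 1: "B * \<sigma> h n ^ (m - 1) \<le> B * (a ^ (m - 1) * h ^ (m - 1) * real n powr s)"
        using B by (rule mult_left_mono)
      have "real ((m - 1) * n) / \<sigma> h n = real (m - 1) / (a * h) * real n powr (1 - \<theta>)"
        using n by (simp add: \<sigma> powr_diff)
      also have "real n powr (1 - \<theta>) = real n powr (1 - \<theta> - s) * real n powr s"
        using n by (simp add: powr_add[symmetric])
      also have "real (m - 1) / (a * h) * (real n powr (1 - \<theta> - s) * real n powr s)
          \<le> real (m - 1) / (a * h) * (a * h ^ m / real (m - 1) * real n powr s)"
        using elim(2) a h by (intro mult_left_mono mult_right_mono) auto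
      also have "\<dots> = h ^ (m - 1) * real n powr s"
        using a h m by (simp add: m')
      finally have 2: "real ((m - 1) * n) / \<sigma> h n \<le> h ^ (m - 1) * real n powr s" .
      have "\<Lambda> n \<le> B * (a ^ (m - 1) * h ^ (m - 1) * real n powr s) + h ^ (m - 1) * real n powr s + h * real n powr s"
        using 1 2 by (simp add: \<Lambda>_def)
      also have "\<dots> \<le> (B * a ^ (m - 1) + 1) * (h + h ^ (m - 1)) * real n powr s"
        using h a B by (simp add: algebra_simps)
      finally have "\<Lambda> n ^ n \<le> ((B * a ^ (m - 1) + 1) * (h + h ^ (m - 1)) * real n powr s) ^ n"
        by (intro power_mono \<Lambda>0)
      also have "\<dots> = ((B * a ^ (m - 1) + 1) * (h + h ^ (m - 1))) ^ n * (real n powr s) ^ n"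
        by (simp add: power_mult_distrib)
      also have "\<dots> \<le> ((B * a ^ (m - 1) + 1) * (h + h ^ (m - 1))) ^ n * (exp s ^ n * fact n powr s)"
        using a B h s by (intro mult_left_mono powr_times_power_le) auto
      also have "\<dots> = (K * (h + h ^ (m - 1))) ^ n * fact n powr s"
        by (simp add: K_def power_mult_distrib mult_ac)
      finally show ?case .
    qed
    moreover have "\<Lambda> n ^ n \<ge> 0" for n using \<Lambda>0 by simp
    moreover have "(K * (h + h ^ (m - 1))) ^ n * fact n powr s > 0" for n
      using K h by (intro mult_pos_pos zero_less_power add_pos_pos) auto
    ultimately show ?thesis
      unfolding \<Lambda>_def[symmetric]
      using eventually_le_imp_le_const_mult[of "\<lambda>n. \<Lambda> n ^ n"
          "\<lambda>n. (K * (h + h ^ (m - 1))) ^ n * fact n powr s"] by metis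
  qed
  then show ?thesis using that K by blast
qed


section \<open>Multiplication by the exponential is bounded between Gelfand--Shilov norms\<close>

lemma mi_fact_pos: "mi_fact \<alpha> > 0"
  by (auto simp: mi_fact_def intro!: prod_pos)

lemma fact_add_binomial:
  "(fact (a + b) :: real) = real ((a + b) choose a) * (fact a * fact b)"
  using binomial_fact_lemma[of a "a + b"]
  by (metis add_diff_cancel_left' le_add1 mult.commute of_nat_fact of_nat_mult)

lemma fact_add_bounds:
  shows "fact a * fact b \<le> (fact (a + b) :: real)"
    and "(fact (a + b) :: real) \<le> 2 ^ (a + b) * (fact a * fact b)"
proof -
  have "real 1 \<le> real ((a + b) choose a)"
    by (subst of_nat_le_iff) (simp add: Suc_le_eq)
  then show "fact a * fact b \<le> (fact (a + b) :: real)"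
    unfolding fact_add_binomial using mult_right_mono[of 1 _ "fact a * fact b :: real"] by simp
  have "real ((a + b) choose a) \<le> real (2 ^ (a + b))"
    using binomial_le_pow2 of_nat_le_iff by blast
  then show "(fact (a + b) :: real) \<le> 2 ^ (a + b) * (fact a * fact b)"
    unfolding fact_add_binomial by (intro mult_right_mono) auto
qed

lemma mi_fact_le_fact_abs: "mi_fact \<alpha> \<le> fact (mi_abs \<alpha>)"
proof -
  have "(\<Prod>j\<in>J. fact (\<alpha> j)) \<le> (fact (\<Sum>j\<in>J. \<alpha> j) :: real)" if "finite J" for J
    using that
  proof induction
    case (insert j J)
    then have "(\<Prod>j\<in>insert j J. fact (\<alpha> j)) \<le> fact (\<alpha> j) * (fact (\<Sum>j\<in>J. \<alpha> j) :: real)"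
      by (simp add: mult_left_mono)
    also have "\<dots> \<le> fact (\<alpha> j + (\<Sum>j\<in>J. \<alpha> j))" by (rule fact_add_bounds)
    finally show ?case using insert by simp
  qed simp
  then show ?thesis by (simp add: mi_fact_def mi_abs_def)
qed

text \<open>Together with the preceding lemma, this allows \<open>\<alpha>!\<close> to be replaced by
  \<open>\<bar>\<alpha>\<bar>!\<close> at the cost of a factor \<open>const ^
  \<bar>\<alpha>\<bar>\<close>, which the parameter \<open>h\<close> of the norm absorbs.\<close>

lemma fact_abs_le_mi_fact:
  fixes \<alpha> :: "'n::finite mindex"
  shows "fact (mi_abs \<alpha>) \<le> (2 ^ CARD('n)) ^ mi_abs \<alpha> * mi_fact \<alpha>"
proof -
  have "(fact (\<Sum>j\<in>J. \<alpha> j) :: real) \<le> (2 ^ card J) ^ (\<Sum>j\<in>J. \<alpha> j) * (\<Prod>j\<in>J. fact (\<alpha> j))"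
    if "finite J" for J
    using that
  proof induction
    case (insert j J)
    let ?S = "\<Sum>j\<in>J. \<alpha> j"
    have "(fact (\<alpha> j + ?S) :: real) \<le> 2 ^ (\<alpha> j + ?S) * (fact (\<alpha> j) * fact ?S)"
      by (rule fact_add_bounds)
    also have "\<dots> \<le> 2 ^ (\<alpha> j + ?S) * (fact (\<alpha> j) * ((2 ^ card J) ^ ?S * (\<Prod>j\<in>J. fact (\<alpha> j))))"
      using insert.IH by (intro mult_left_mono) auto
    also have "\<dots> \<le> 2 ^ (\<alpha> j + ?S) * (fact (\<alpha> j) * ((2 ^ card J) ^ (\<alpha> j + ?S) * (\<Prod>j\<in>J. fact (\<alpha> j))))"
      by (intro mult_left_mono mult_right_mono power_increasing) (auto intro: prod_nonneg)
    also have "\<dots> = (2 ^ card (insert j J)) ^ (\<alpha> j + ?S) * (\<Prod>j\<in>insert j J. fact (\<alpha> j))"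
      using insert by (simp add: power_mult_distrib mult_ac)
    finally show ?case using insert by simp
  qed simp
  then show ?thesis by (simp add: mi_fact_def mi_abs_def)
qed

lemma fact_powr_le: "k \<le> P \<Longrightarrow> \<theta> \<ge> 0 \<Longrightarrow> fact k powr \<theta> \<le> (real P powr \<theta>) ^ k"
proof (induction k)
  case (Suc k)
  have "fact (Suc k) powr \<theta> = real (Suc k) powr \<theta> * fact k powr \<theta>"
    by (simp add: powr_mult del: of_nat_Suc)
  also have "\<dots> \<le> real P powr \<theta> * (real P powr \<theta>) ^ k"
    using Suc by (intro mult_mono powr_mono2) auto
  finally show ?case by simp
qed simp

lemma gs_norm_le_iff:
  fixes f :: "real^'n::finite \<Rightarrow> complex"
  assumes "h > 0" "N \<ge> 0"
  shows "gs_norm \<theta> s h f \<le> ennreal N \<longleftrightarrow> (\<forall>\<alpha> \<beta> x. \<bar>mi_power x \<alpha>\<bar> * cmod (mi_partial \<beta> f x)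
    \<le> N * (h ^ (mi_abs \<alpha> + mi_abs \<beta>) * mi_fact \<alpha> powr \<theta> * mi_fact \<beta> powr s))"
proof -
  have "cmod (complex_of_real (mi_power x \<alpha>) * mi_D \<beta> f x) = \<bar>mi_power x \<alpha>\<bar> * cmod (mi_partial \<beta> f x)"
    for x :: "real^'n" and \<alpha> \<beta>
    by (simp add: mi_D_def norm_mult norm_power_int)
  moreover have "0 < h ^ (mi_abs \<alpha> + mi_abs \<beta>) * mi_fact \<alpha> powr \<theta> * mi_fact \<beta> powr s"
    for \<alpha> \<beta> :: "'n mindex"
    using assms mi_fact_pos[of \<alpha>] mi_fact_pos[of \<beta>] by (intro mult_pos_pos) auto
  ultimately show ?thesis
    unfolding gs_norm_def
    by (simp add: SUP_le_iff split_paired_all ennreal_le_iff[OF assms(2)] mi_abs_add pos_divide_le_eq del: power_add)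
qed

lemma powr_mult_power:
  fixes a b t :: real
  shows "(a ^ k * b) powr t = (a powr t) ^ k * b powr t"
  by (induction k) (simp_all add: powr_mult mult.assoc)

lemma exp_mult_eq_exp_term:
  assumes q: "\<And>x. q x = (\<Sum>\<alpha>\<in>S. c \<alpha> * mi_power x \<alpha>)"
  shows "exp_mult q f = exp_term (phase c S) f (\<lambda>_. 0) []"
  by (rule ext) (simp add: exp_mult_def exp_term_def phase_def q mi_power_def sum_distrib_left mult.assoc)

text \<open>The pointwise estimate in terms of \<open>\<bar>\<alpha>\<bar>!\<close> and the order of
  differentiation.  The decay factor \<open>x\<^sup>\<alpha>\<close> is combined with the
  monomials \<open>x\<^sup>\<mu>\<close> of the family, and \<open>(a + k)! \<le> 2 ^ (a + k) a!
  k!\<close> separates the two again.\<close>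

lemma iter_partial_deriv_exp_mult_bound:
  fixes f :: "real^'n::finite \<Rightarrow> complex" and m :: nat
  assumes q: "\<And>x. q x = (\<Sum>\<alpha>\<in>S. c \<alpha> * mi_power x \<alpha>)"
    and deg: "\<And>\<alpha>. \<alpha> \<in> S \<Longrightarrow> mi_abs \<alpha> \<le> m"
    and f: "smooth f" and h: "h > 0" and N: "N \<ge> 0" and \<theta>: "\<theta> \<ge> 0" and s: "s \<ge> 0"
    and bound: "\<And>\<alpha> ls. \<bar>mi_power x \<alpha>\<bar> * cmod (iter_partial_deriv ls f x)
      \<le> N * (h ^ (mi_abs \<alpha> + length ls) * fact (mi_abs \<alpha>) powr \<theta> * fact (length ls) powr s)"
  defines "\<sigma> \<equiv> \<lambda>n. max 1 (2 powr \<theta> * h * real ((m - 1) * n) powr \<theta>)"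
  shows "\<bar>mi_power x \<alpha>\<bar> * cmod (iter_partial_deriv js (exp_mult q f) x)
    \<le> N * (2 powr \<theta> * h) ^ mi_abs \<alpha> * fact (mi_abs \<alpha>) powr \<theta> *
      (real m * (\<Sum>\<alpha>\<in>S. \<bar>c \<alpha>\<bar>) * \<sigma> (length js) ^ (m - 1) + real ((m - 1) * length js) / \<sigma> (length js)
        + h * real (length js) powr s) ^ length js"
proof (cases "mi_power x \<alpha> = 0")
  case True
  have "0 \<le> \<sigma> n" for n by (simp add: \<sigma>_def)
  then show ?thesis using True N h
    by (auto intro!: mult_nonneg_nonneg add_nonneg_nonneg sum_nonneg divide_nonneg_nonneg zero_le_power)
next
  case False
  define n where "n = length js"
  define P where "P = (m - 1) * n"
  define D where "D = N * (2 powr \<theta> * h) ^ mi_abs \<alpha> * fact (mi_abs \<alpha>) powr \<theta>"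
  have D: "D \<ge> 0" using N h by (simp add: D_def)
  have \<sigma>1: "\<sigma> n \<ge> 1" by (simp add: \<sigma>_def)
  \<comment> \<open>The factor \<open>x\<^sup>\<alpha>\<close> is moved into the constant of the weight, whence the division.\<close>
  have base: "\<bar>mi_power x \<mu>\<bar> * cmod (iter_partial_deriv ls f x)
      \<le> D / \<bar>mi_power x \<alpha>\<bar> * \<sigma> n ^ mi_abs \<mu> * (h * real n powr s) ^ length ls"
    if \<mu>: "mi_abs \<mu> \<le> P" and ls: "length ls \<le> n" for \<mu> ls
  proof -
    let ?a = "mi_abs \<alpha>" and ?k = "mi_abs \<mu>" and ?l = "length ls"
    have "\<bar>mi_power x \<alpha>\<bar> * (\<bar>mi_power x \<mu>\<bar> * cmod (iter_partial_deriv ls f x))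
        \<le> N * (h ^ (?a + ?k + ?l) * fact (?a + ?k) powr \<theta> * fact ?l powr s)"
      using bound[of "\<lambda>i. \<alpha> i + \<mu> i" ls] by (simp add: mi_power_add mi_abs_add abs_mult mult_ac)
    also have "\<dots> \<le> N * (h ^ (?a + ?k + ?l) *
        ((2 powr \<theta>) ^ (?a + ?k) * (fact ?a powr \<theta> * (real P powr \<theta>) ^ ?k)) * (real n powr s) ^ ?l)"
    proof -
      have "fact (?a + ?k) powr \<theta> \<le> (2 ^ (?a + ?k) * (fact ?a * fact ?k)) powr \<theta>"
        using fact_add_bounds(2)[of ?a ?k] \<theta> by (intro powr_mono2) auto
      also have "\<dots> = (2 powr \<theta>) ^ (?a + ?k) * (fact ?a powr \<theta> * fact ?k powr \<theta>)"
        by (subst powr_mult_power) (auto simp: powr_mult)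
      also have "\<dots> \<le> (2 powr \<theta>) ^ (?a + ?k) * (fact ?a powr \<theta> * (real P powr \<theta>) ^ ?k)"
        using fact_powr_le[OF \<mu> \<theta>] by (intro mult_left_mono) auto
      finally show ?thesis
        using fact_powr_le[OF ls s] N h by (intro mult_left_mono mult_mono) auto
    qed
    also have "\<dots> = D * (2 powr \<theta> * h * real P powr \<theta>) ^ ?k * (h * real n powr s) ^ ?l"
      by (simp add: D_def power_add power_mult_distrib mult_ac)
    also have "\<dots> \<le> D * \<sigma> n ^ ?k * (h * real n powr s) ^ ?l"
      using D h by (intro mult_left_mono mult_right_mono power_mono) (auto simp: \<sigma>_def P_def)
    finally show ?thesis using False by (simp add: field_simps)
  qed
  have "cmod (iter_partial_deriv js (exp_term (phase c S) f (\<lambda>_. 0) []) x)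
    \<le> D / \<bar>mi_power x \<alpha>\<bar> * (real m * (\<Sum>\<alpha>\<in>S. \<bar>c \<alpha>\<bar>) * \<sigma> n ^ (m - 1) + real P / \<sigma> n + h * real n powr s) ^ length js
       * \<sigma> n ^ mi_abs (\<lambda>_::'n. 0) * (h * real n powr s) ^ length ([] :: 'n list)"
    by (rule iter_partial_deriv_exp_term_bound[OF f deg \<sigma>1 _ _ base])
      (use h D in \<open>auto simp: P_def n_def mi_abs_def\<close>)
  then show ?thesis
    unfolding exp_mult_eq_exp_term[OF q]
    using False by (simp add: D_def n_def P_def mi_abs_def field_simps)
qed

text \<open>The growth factor contributes \<open>K\<^sub>1\<close>, the separation of factorials \<open>2
  powr \<theta>\<close>, and the two passages from \<open>\<bar>\<alpha>\<bar>!\<close> and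
  \<open>\<bar>\<beta>\<bar>!\<close> to \<open>\<alpha>!\<close> and \<open>\<beta>!\<close>
  powers of \<open>d = 2 ^ CARD('n)\<close>; \<open>K\<close> collects them.\<close>

lemma gs_norm_exp_mult_bound:
  fixes q :: "real^'n::finite \<Rightarrow> real" and m :: nat and s \<theta> :: real
  assumes q: "real_poly_of_degree q m" and m: "m \<ge> 2" and \<theta>: "\<theta> > 0"
    and s: "s \<ge> (real m - 1) * \<theta>" "(real m - 1) * \<theta> \<ge> 1"
  obtains K where "K > 0" "\<And>h. h > 0 \<Longrightarrow> \<exists>C>0. \<forall>f. smooth f \<longrightarrow>
    gs_norm \<theta> s (K * (h + h ^ (m - 1))) (exp_mult q f) \<le> ennreal C * gs_norm \<theta> s h f"
proof -
  obtain c :: "'n mindex \<Rightarrow> real" where c: "finite {\<alpha>. c \<alpha> \<noteq> 0}"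
    "\<And>x. q x = (\<Sum>\<alpha> | c \<alpha> \<noteq> 0. c \<alpha> * mi_power x \<alpha>)"
    "\<And>\<alpha>. c \<alpha> \<noteq> 0 \<Longrightarrow> mi_abs \<alpha> \<le> m"
    using q unfolding real_poly_of_degree_def by blast
  define S where "S = {\<alpha>. c \<alpha> \<noteq> 0}"
  define B where "B = real m * (\<Sum>\<alpha>\<in>S. \<bar>c \<alpha>\<bar>)"
  have B: "B \<ge> 0" by (simp add: B_def sum_nonneg)
  define \<sigma> where "\<sigma> h n = max 1 (2 powr \<theta> * h * real ((m - 1) * n) powr \<theta>)" for h :: real and n :: nat
  define \<Lambda> where "\<Lambda> h n = B * \<sigma> h n ^ (m - 1) + real ((m - 1) * n) / \<sigma> h n + h * real n powr s" for h n
  obtain K1 where K1: "K1 > 0" "\<And>h. h > 0 \<Longrightarrow> \<exists>C>0. \<forall>n. \<Lambda> h n ^ n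
      \<le> C * ((K1 * (h + h ^ (m - 1))) ^ n * fact n powr s)"
    using growth_factor_bound[OF m \<theta> B s] unfolding \<Lambda>_def \<sigma>_def by metis
  define d :: real where "d = 2 ^ CARD('n)"
  define K where "K = 2 powr \<theta> * d powr \<theta> + K1 * d powr s"
  have d: "d > 0" by (simp add: d_def)
  have K: "K > 0" using d K1 by (simp add: K_def add_pos_pos)
  have s0: "s > 0" using s by linarith
  have "\<exists>C>0. \<forall>f. smooth f \<longrightarrow>
    gs_norm \<theta> s (K * (h + h ^ (m - 1))) (exp_mult q f) \<le> ennreal C * gs_norm \<theta> s h f" if h: "h > 0" for h
  proof -
    define g where "g = h + h ^ (m - 1)"
    have g: "g > 0" "h \<le> g" using h by (simp_all add: g_def add_pos_pos)
    obtain C where C: "C > 0" "\<And>n. \<Lambda> h n ^ n \<le> C * ((K1 * g) ^ n * fact n powr s)"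
      using K1(2)[OF h] by (auto simp: g_def)
    have "gs_norm \<theta> s (K * g) (exp_mult q f) \<le> ennreal C * gs_norm \<theta> s h f" if f: "smooth f" for f
    proof (cases "gs_norm \<theta> s h f")
      case top
      then show ?thesis using C by (simp add: ennreal_mult_top)
    next
      case (real N)
      have bound: "\<bar>mi_power x \<alpha>\<bar> * cmod (iter_partial_deriv ls f x)
        \<le> N * (h ^ (mi_abs \<alpha> + length ls) * fact (mi_abs \<alpha>) powr \<theta> * fact (length ls) powr s)"
        for x \<alpha> ls
      proof -
        have "\<bar>mi_power x \<alpha>\<bar> * cmod (iter_partial_deriv ls f x)
          \<le> N * (h ^ (mi_abs \<alpha> + length ls) * mi_fact \<alpha> powr \<theta> * mi_fact (count_list ls) powr s)"
          using gs_norm_le_iff[OF h real(1), of \<theta> s f] real(2)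
          by (simp add: iter_partial_deriv_eq_mi_partial[OF f] flip: mi_abs_count_list[of ls])
        also have "\<dots> \<le> N * (h ^ (mi_abs \<alpha> + length ls) * fact (mi_abs \<alpha>) powr \<theta> * fact (length ls) powr s)"
          using mi_fact_le_fact_abs[of \<alpha>] mi_fact_le_fact_abs[of "count_list ls"] h real(1) s0 \<theta>
            mi_fact_pos[of \<alpha>] mi_fact_pos[of "count_list ls"]
          by (intro mult_left_mono mult_mono powr_mono2) (auto simp: mi_abs_count_list)
        finally show ?thesis .
      qed
      have "\<bar>mi_power x \<alpha>\<bar> * cmod (mi_partial \<beta> (exp_mult q f) x)
          \<le> C * N * ((K * g) ^ (mi_abs \<alpha> + mi_abs \<beta>) * mi_fact \<alpha> powr \<theta> * mi_fact \<beta> powr s)" for \<alpha> \<beta> x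
      proof -
        obtain js where js: "mi_partial \<beta> = iter_partial_deriv js" "\<And>j. count_list js j = \<beta> j"
          using mi_partial_conv[of \<beta>] by metis
        let ?a = "mi_abs \<alpha>" and ?n = "length js"
        have n: "mi_abs \<beta> = ?n" using mi_abs_count_list[of js] js(2) by (simp add: mi_abs_def)
        have fa: "fact ?a powr \<theta> \<le> (d powr \<theta>) ^ ?a * mi_fact \<alpha> powr \<theta>"
          using fact_abs_le_mi_fact[of \<alpha>] \<theta> mi_fact_pos[of \<alpha>] d
          by (subst powr_mult_power[symmetric]) (auto simp: d_def intro!: powr_mono2)
        have fb: "fact ?n powr s \<le> (d powr s) ^ ?n * mi_fact \<beta> powr s"
          using fact_abs_le_mi_fact[of \<beta>] s0 mi_fact_pos[of \<beta>] d
          by (subst powr_mult_power[symmetric]) (auto simp: d_def n intro!: powr_mono2)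
        have "\<bar>mi_power x \<alpha>\<bar> * cmod (mi_partial \<beta> (exp_mult q f) x)
          \<le> N * (2 powr \<theta> * h) ^ ?a * fact ?a powr \<theta> * \<Lambda> h ?n ^ ?n"
          unfolding js(1) \<Lambda>_def \<sigma>_def B_def
          by (rule iter_partial_deriv_exp_mult_bound[OF c(2)[folded S_def] _ f h real(1) _ _ bound])
            (use c(3) \<theta> s0 in \<open>auto simp: S_def\<close>)
        also have "\<dots> \<le> N * (2 powr \<theta> * h) ^ ?a * ((d powr \<theta>) ^ ?a * mi_fact \<alpha> powr \<theta>)
            * (C * ((K1 * g) ^ ?n * ((d powr s) ^ ?n * mi_fact \<beta> powr s)))"
        proof -
          have "\<Lambda> h ?n ^ ?n \<le> C * ((K1 * g) ^ ?n * ((d powr s) ^ ?n * mi_fact \<beta> powr s))"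
            by (rule order_trans[OF C(2)]) (use C(1) K1(1) g fb in \<open>intro mult_left_mono; simp\<close>)
          moreover have "0 \<le> \<Lambda> h ?n"
            using B h by (auto simp: \<Lambda>_def \<sigma>_def intro!: add_nonneg_nonneg mult_nonneg_nonneg divide_nonneg_nonneg)
          ultimately show ?thesis
            using fa real(1) h by (intro mult_mono mult_left_mono) auto
        qed
        also have "\<dots> = C * N * ((2 powr \<theta> * d powr \<theta> * h) ^ ?a * (K1 * d powr s * g) ^ ?n
            * mi_fact \<alpha> powr \<theta> * mi_fact \<beta> powr s)"
          by (simp add: power_mult_distrib mult_ac)
        also have "\<dots> \<le> C * N * ((K * g) ^ ?a * (K * g) ^ ?n * mi_fact \<alpha> powr \<theta> * mi_fact \<beta> powr s)"
          using C(1) real(1) h g K1(1) d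
          by (intro mult_left_mono mult_right_mono mult_mono power_mono) (auto simp: K_def)
        finally show ?thesis by (simp add: n power_add)
      qed
      then have "gs_norm \<theta> s (K * g) (exp_mult q f) \<le> ennreal (C * N)"
        using K g C(1) real(1) by (subst gs_norm_le_iff) auto
      then show ?thesis using real C(1) by (simp add: ennreal_mult)
    qed
    then show ?thesis using C(1) by (auto simp: g_def)
  qed
  then show ?thesis using that K by blast
qed


section \<open>From norm bounds to continuity\<close>

text \<open>The triangle inequality is what makes the preimage of a subbasic ball around \<open>f0\<close> a neighbourhood
  of each of its points: a point at distance \<open>r < e\<close> leaves room for a ball of radius \<open>(e - r) / C\<close>.\<close>

lemma continuous_map_seminorm_topology:
  fixes T :: "('a \<Rightarrow> complex) \<Rightarrow> ('b \<Rightarrow> complex)"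
  assumes P: "P \<noteq> {}" "\<And>p. p \<in> P \<Longrightarrow> p (\<lambda>x. 0) = 0"
    and maps: "\<And>f. f \<in> V \<Longrightarrow> T f \<in> V'"
    and triangle: "\<And>p f g k. p \<in> P' \<Longrightarrow> f \<in> V' \<Longrightarrow> g \<in> V' \<Longrightarrow> k \<in> V' \<Longrightarrow>
      p (\<lambda>x. f x - k x) \<le> p (\<lambda>x. f x - g x) + p (\<lambda>x. g x - k x)"
    and P': "P' \<noteq> {}" and zero: "\<And>p. p \<in> P' \<Longrightarrow> p (\<lambda>x. 0) = 0"
    and bound: "\<And>p'. p' \<in> P' \<Longrightarrow> \<exists>p\<in>P. \<exists>C>0. \<forall>f\<in>V. \<forall>g\<in>V.
      p' (\<lambda>x. T f x - T g x) \<le> ennreal C * p (\<lambda>x. f x - g x)"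
  shows "continuous_map (seminorm_topology V P) (seminorm_topology V' P') T"
  unfolding seminorm_topology_def[of V']
proof (rule continuous_on_generated_topo)
  have ts: "topspace (seminorm_topology V P) = V"
    using P by (rule topspace_seminorm_topology)
  fix U assume "U \<in> {{g \<in> V'. p (\<lambda>x. g x - f x) < ennreal e} | p f e. p \<in> P' \<and> f \<in> V' \<and> e > 0}"
  then obtain p' f0 e where p': "p' \<in> P'" and f0: "f0 \<in> V'" and "e > 0"
    and U: "U = {g \<in> V'. p' (\<lambda>x. g x - f0 x) < ennreal e}" by blast
  obtain p C where p: "p \<in> P" and C: "C > 0"
    and bd: "\<And>f g. f \<in> V \<Longrightarrow> g \<in> V \<Longrightarrow> p' (\<lambda>x. T f x - T g x) \<le> ennreal C * p (\<lambda>x. f x - g x)"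
    using bound[OF p'] by blast
  show "openin (seminorm_topology V P) (T -` U \<inter> topspace (seminorm_topology V P))"
    unfolding ts
  proof (subst openin_subopen, intro ballI)
    fix f assume "f \<in> T -` U \<inter> V"
    then have f: "f \<in> V" and less: "p' (\<lambda>x. T f x - f0 x) < ennreal e" by (auto simp: U)
    obtain r where r: "p' (\<lambda>x. T f x - f0 x) = ennreal r" "0 \<le> r"
      using less by (cases "p' (\<lambda>x. T f x - f0 x)") auto
    with less have "r < e" by (simp add: ennreal_less_iff)
    note r = r this
    define W where "W = {g \<in> V. p (\<lambda>x. g x - f x) < ennreal ((e - r) / C)}"
    have "openin (seminorm_topology V P) W"
      unfolding seminorm_topology_def W_def using p f r C
      by (intro topology_generated_by_Basis) (auto intro!: exI[of _ p] exI[of _ f] exI[of _ "(e - r) / C"])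
    moreover have "f \<in> W" using f r C P(2)[OF p] by (simp add: W_def)
    moreover have "W \<subseteq> T -` U \<inter> V"
    proof
      fix g assume "g \<in> W"
      then have g: "g \<in> V" "p (\<lambda>x. g x - f x) < ennreal ((e - r) / C)" by (auto simp: W_def)
      have "ennreal C * p (\<lambda>x. g x - f x) < ennreal C * ennreal ((e - r) / C)"
        using g(2) C by (intro ennreal_mult_strict_left_mono) auto
      also have "\<dots> = ennreal (e - r)" using C r by (simp flip: ennreal_mult)
      finally have "p' (\<lambda>x. T g x - T f x) < ennreal (e - r)"
        using bd[OF g(1) f] by (rule le_less_trans[rotated])
      then have "p' (\<lambda>x. T g x - T f x) + ennreal r < ennreal (e - r) + ennreal r"
        by (subst (1 2) add.commute) (simp add: ennreal_add_left_cancel_less)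
      also have "\<dots> = ennreal e" using r by (simp flip: ennreal_plus)
      finally have "p' (\<lambda>x. T g x - f0 x) < ennreal e"
        using triangle[OF p' maps[OF g(1)] maps[OF f] f0] r(1) by (metis le_less_trans)
      then show "g \<in> T -` U \<inter> V" using g maps by (simp add: U)
    qed
    ultimately show "\<exists>W. openin (seminorm_topology V P) W \<and> f \<in> W \<and> W \<subseteq> T -` U \<inter> V" by blast
  qed
next
  have "T ` topspace (seminorm_topology V P) \<subseteq> V'"
    using maps by (simp add: topspace_seminorm_topology[of P V] P image_subset_iff)
  also have "\<dots> = topspace (seminorm_topology V' P')"
    using topspace_seminorm_topology[of P' V'] P' zero by simp
  finally show "T ` topspace (seminorm_topology V P)
      \<subseteq> \<Union> {{g \<in> V'. p (\<lambda>x. g x - f x) < ennreal e} | p f e. p \<in> P' \<and> f \<in> V' \<and> e > 0}"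
    by (simp only: seminorm_topology_def[of V'] topology_generated_by_topspace)
qed

lemma exp_mult_lin:
  "exp_mult q (\<lambda>x. a * f x + b * g x) = (\<lambda>x. a * exp_mult q f x + b * exp_mult q g x)"
  by (auto simp: exp_mult_def algebra_simps)

lemma exp_mult_diff: "(\<lambda>x. exp_mult q f x - exp_mult q g x) = exp_mult q (\<lambda>x. f x - g x)"
  by (auto simp: exp_mult_def algebra_simps)

lemma smooth_diff: "smooth f \<Longrightarrow> smooth g \<Longrightarrow> smooth (\<lambda>x. f x - g x)"
  using smooth_lin[of f g 1 "-1"] by simp

lemma gs_norm_triangle:
  assumes "h > 0" "smooth f" "smooth g" "smooth k"
  shows "gs_norm \<theta> s h (\<lambda>x. f x - k x) \<le> gs_norm \<theta> s h (\<lambda>x. f x - g x) + gs_norm \<theta> s h (\<lambda>x. g x - k x)"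
  using gs_norm_lin[OF assms(1) smooth_diff[OF assms(2,3)] smooth_diff[OF assms(3,4)], of \<theta> s 1 1]
  by simp

text \<open>Addition, scalar multiplication and convexity commute with the linear map \<open>T\<close>, so
  every requirement on the pulled back topology is the one on \<open>X\<close> composed with
  \<open>T\<close>.\<close>

lemma locally_convex_pullback:
  assumes X: "locally_convex_topology X" "topspace X = V"
    and T: "\<And>f. f \<in> V \<Longrightarrow> T f \<in> V"
    and V: "\<And>f g a b. f \<in> V \<Longrightarrow> g \<in> V \<Longrightarrow> (\<lambda>x. a * f x + b * g x) \<in> V"
    and lin: "\<And>f g a b. T (\<lambda>x. a * f x + b * g x) = (\<lambda>x. a * T f x + b * T g x)"
  shows "locally_convex_topology (pullback_topology V T X)" "topspace (pullback_topology V T X) = V"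
proof -
  let ?Y = "pullback_topology V T X"
  show ts: "topspace ?Y = V" using T X(2) by (auto simp: topspace_pullback_topology)
  have contT: "continuous_map ?Y X T"
    using continuous_map_pullback[of X X id V T] by simp
  have T_add: "T (\<lambda>x. f x + g x) = (\<lambda>x. T f x + T g x)" for f g
    using lin[of 1 f 1 g] by simp
  have T_mult: "T (\<lambda>x. a * f x) = (\<lambda>x. a * T f x)" for f a
    using lin[of a f 0 f] by simp
  have T_zero: "T (\<lambda>x. 0) = (\<lambda>x. 0)"
    using T_mult[of 0 "\<lambda>x. 0"] by simp
  have 0: "(\<lambda>x. 0) \<in> V" using X by (auto simp: locally_convex_topology_def)
  have add: "continuous_map (prod_topology X X) X (\<lambda>(f, g). \<lambda>x. f x + g x)"
    and mult: "continuous_map (prod_topology euclidean X) X (\<lambda>(c, f). \<lambda>x. c * f x)"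
    and base: "\<And>U. openin X U \<Longrightarrow> (\<lambda>x. 0) \<in> U \<Longrightarrow>
       \<exists>W. openin X W \<and> convex_funs W \<and> (\<lambda>x. 0) \<in> W \<and> W \<subseteq> U"
    using X by (auto simp: locally_convex_topology_def)
  show "locally_convex_topology ?Y"
    unfolding locally_convex_topology_def
  proof (intro conjI allI impI)
    show "(\<lambda>x. 0) \<in> topspace ?Y" using 0 ts by simp
    show "continuous_map (prod_topology ?Y ?Y) ?Y (\<lambda>(f, g). \<lambda>x. f x + g x)"
    proof (rule continuous_map_pullback')
      have "continuous_map (prod_topology ?Y ?Y) (prod_topology X X) (\<lambda>(f, g). (T f, T g))"
        using contT by (simp add: continuous_map_prod_top)
      from continuous_map_compose[OF this add]
      show "continuous_map (prod_topology ?Y ?Y) X (T \<circ> (\<lambda>(f, g). \<lambda>x. f x + g x))"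
        by (simp add: comp_def case_prod_unfold T_add)
      show "topspace (prod_topology ?Y ?Y) \<subseteq> (\<lambda>(f, g). \<lambda>x. f x + g x) -` V"
        using V[of _ _ 1 1] by (auto simp: ts)
    qed
    show "continuous_map (prod_topology euclidean ?Y) ?Y (\<lambda>(c, f). \<lambda>x. c * f x)"
    proof (rule continuous_map_pullback')
      have "continuous_map (prod_topology euclidean ?Y) (prod_topology euclidean X) (\<lambda>(c, f). (id c, T f))"
        using contT by (simp only: continuous_map_prod_top) auto
      from continuous_map_compose[OF this mult]
      show "continuous_map (prod_topology euclidean ?Y) X (T \<circ> (\<lambda>(c, f). \<lambda>x. c * f x))"
        by (simp add: comp_def case_prod_unfold T_mult)
      show "topspace (prod_topology euclidean ?Y) \<subseteq> (\<lambda>(c, f). \<lambda>x. c * f x) -` V"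
        using V[of _ _ _ 0] by (auto simp: ts)
    qed
    fix U assume "openin ?Y U \<and> (\<lambda>x. 0) \<in> U"
    then obtain U' where U': "openin X U'" "U = T -` U' \<inter> V" "(\<lambda>x. 0) \<in> U'"
      using T_zero by (auto simp: openin_pullback_topology)
    then obtain W where W: "openin X W" "convex_funs W" "(\<lambda>x. 0) \<in> W" "W \<subseteq> U'"
      using base by blast
    show "\<exists>W. openin ?Y W \<and> convex_funs W \<and> (\<lambda>x. 0) \<in> W \<and> W \<subseteq> U"
    proof (intro exI[of _ "T -` W \<inter> V"] conjI)
      show "openin ?Y (T -` W \<inter> V)" using W by (auto simp: openin_pullback_topology)
      show "convex_funs (T -` W \<inter> V)"
        using W(2) V by (auto simp: convex_funs_def lin)
    qed (use W U' T_zero 0 in auto)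
  qed
qed

text \<open>The inductive limit topology is generated by the open sets of all admissible topologies
  \<open>X\<close>.  Since \<open>T\<close> maps each step continuously into some step, the
  pullback of \<open>X\<close> along \<open>T\<close> is admissible again; preimages of generators
  are therefore generators.\<close>

lemma continuous_map_roumieu_topology:
  fixes T :: "(real^'n::finite \<Rightarrow> complex) \<Rightarrow> real^'n \<Rightarrow> complex"
  assumes lin: "\<And>f g a b. T (\<lambda>x. a * f x + b * g x) = (\<lambda>x. a * T f x + b * T g x)"
    and cont: "\<And>h. h > 0 \<Longrightarrow> \<exists>h'>0. continuous_map (gs_topology \<theta> s h) (gs_topology \<theta> s h') T"
  shows "continuous_map (roumieu_topology \<theta> s) (roumieu_topology \<theta> s) T"
proof -
  let ?V = "roumieu \<theta> s :: (real^'n \<Rightarrow> complex) set"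
  have T: "T f \<in> ?V" if f: "f \<in> ?V" for f
  proof -
    obtain h where h: "h > 0" "f \<in> gs_space \<theta> s h" using f by (auto simp: roumieu_def)
    obtain h' where "h' > 0" "continuous_map (gs_topology \<theta> s h) (gs_topology \<theta> s h') T"
      using cont[OF h(1)] by blast
    then show ?thesis using h by (force simp: roumieu_def dest: continuous_map_image_subset_topspace)
  qed
  show ?thesis
    unfolding roumieu_topology_def[of \<theta> s] 
  proof (rule continuous_on_generated_topo, unfold roumieu_topology_def[symmetric])
    fix U :: "(real^'n \<Rightarrow> complex) set"
    assume "U \<in> {U. \<exists>X. locally_convex_topology X \<and> topspace X = ?V \<and>
              (\<forall>h>0. continuous_map (gs_topology \<theta> s h) X id) \<and> openin X U}"
    then obtain X where X: "locally_convex_topology X" "topspace X = ?V"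
      "\<And>h. h > 0 \<Longrightarrow> continuous_map (gs_topology \<theta> s h) X id" "openin X U" by blast
    let ?Y = "pullback_topology ?V T X"
    have Y: "locally_convex_topology ?Y" "topspace ?Y = ?V"
      by (rule locally_convex_pullback[OF X(1,2)]; use T lin roumieu_lin in blast)+
    have incl: "continuous_map (gs_topology \<theta> s h) ?Y id" if h: "h > 0" for h
    proof (rule continuous_map_pullback')
      obtain h' where h': "h' > 0" "continuous_map (gs_topology \<theta> s h) (gs_topology \<theta> s h') T"
        using cont[OF h] by blast
      show "continuous_map (gs_topology \<theta> s h) X (T \<circ> id)"
        using continuous_map_compose[OF h'(2) X(3)[OF h'(1)]] by (simp add: comp_def)
      show "topspace (gs_topology \<theta> s h) \<subseteq> id -` ?V" using h by (auto simp: roumieu_def)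
    qed
    have "openin ?Y (T -` U \<inter> ?V)" using X(4) by (auto simp: openin_pullback_topology)
    then have "openin (roumieu_topology \<theta> s) (T -` U \<inter> ?V)"
      unfolding roumieu_topology_def using Y incl by (intro topology_generated_by_Basis) blast
    then show "openin (roumieu_topology \<theta> s) (T -` U \<inter> topspace (roumieu_topology \<theta> s))" by simp
  next
    have "T ` ?V \<subseteq> topspace (roumieu_topology \<theta> s)"
      using T by (simp add: image_subset_iff)
    also have "\<dots> = \<Union> {U. \<exists>X. locally_convex_topology X \<and> topspace X = ?V \<and>
              (\<forall>h>0. continuous_map (gs_topology \<theta> s h) X id) \<and> openin X U}"
      unfolding roumieu_topology_def by (rule topology_generated_by_topspace)
    finally show "T ` topspace (roumieu_topology \<theta> s) \<subseteq> \<Union> {U. \<exists>X. locally_convex_topology X \<and> topspace X = ?V \<and>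
              (\<forall>h>0. continuous_map (gs_topology \<theta> s h) X id) \<and> openin X U}"
      unfolding topspace_roumieu_topology .
  qed
qed

lemma smooth_exp_mult_poly:
  assumes "real_poly_of_degree q m" "smooth f"
  shows "smooth (exp_mult q f)"
proof -
  obtain c where "\<And>x. q x = (\<Sum>\<alpha> | c \<alpha> \<noteq> 0. c \<alpha> * mi_power x \<alpha>)"
    using assms(1) unfolding real_poly_of_degree_def by blast
  from exp_mult_eq_exp_term[OF this] show ?thesis
    by (simp only:) (rule smooth_exp_term[OF smooth_phase assms(2)])
qed

lemma continuous_map_gs_topology:
  fixes T :: "(real^'n::finite \<Rightarrow> complex) \<Rightarrow> real^'n \<Rightarrow> complex"
  assumes "h > 0" "h' > 0" "C > 0"
    and smooth: "\<And>f. smooth f \<Longrightarrow> smooth (T f)"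
    and diff: "\<And>f g. (\<lambda>x. T f x - T g x) = T (\<lambda>x. f x - g x)"
    and bound: "\<And>f. smooth f \<Longrightarrow> gs_norm \<theta> s h' (T f) \<le> ennreal C * gs_norm \<theta> s h f"
  shows "continuous_map (gs_topology \<theta> s h) (gs_topology \<theta> s h') T"
  unfolding gs_topology_def
proof (rule continuous_map_seminorm_topology)
  show "T f \<in> gs_space \<theta> s h'" if "f \<in> gs_space \<theta> s h" for f
    using that bound[of f] le_less_trans[of "gs_norm \<theta> s h' (T f)" _ \<infinity>]
    by (auto simp: gs_space_def smooth ennreal_mult_less_top)
  show "\<exists>p\<in>{gs_norm \<theta> s h}. \<exists>C>0. \<forall>f\<in>gs_space \<theta> s h. \<forall>g\<in>gs_space \<theta> s h.
      p' (\<lambda>x. T f x - T g x) \<le> ennreal C * p (\<lambda>x. f x - g x)"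
    if "p' \<in> {gs_norm \<theta> s h'}" for p'
    using that assms(3) by (auto simp: diff gs_space_def intro!: exI[of _ C] bound smooth_diff)
qed (use assms(2) in \<open>auto simp: gs_norm_zero gs_space_def intro!: gs_norm_triangle\<close>)

lemma continuous_map_beurling_topology:
  fixes T :: "(real^'n::finite \<Rightarrow> complex) \<Rightarrow> real^'n \<Rightarrow> complex"
  assumes smooth: "\<And>f. smooth f \<Longrightarrow> smooth (T f)"
    and diff: "\<And>f g. (\<lambda>x. T f x - T g x) = T (\<lambda>x. f x - g x)"
    and bound: "\<And>h'. h' > 0 \<Longrightarrow> \<exists>h>0. \<exists>C>0. \<forall>f. smooth f \<longrightarrow>
      gs_norm \<theta> s h' (T f) \<le> ennreal C * gs_norm \<theta> s h f"
  shows "continuous_map (beurling_topology \<theta> s) (beurling_topology \<theta> s) T"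
  unfolding beurling_topology_def
proof (rule continuous_map_seminorm_topology)
  have sm: "smooth f" if "f \<in> beurling \<theta> s" for f :: "real^'n \<Rightarrow> complex"
  proof -
    have "f \<in> gs_space \<theta> s 1" using that unfolding beurling_def by (rule INT_D) simp
    then show ?thesis by (simp add: gs_space_def)
  qed
  show "T f \<in> beurling \<theta> s" if f: "f \<in> beurling \<theta> s" for f
    unfolding beurling_def
  proof
    fix h' :: real assume "h' \<in> {0<..}"
    then obtain h C where hC: "h > 0" "C > 0"
      "gs_norm \<theta> s h' (T f) \<le> ennreal C * gs_norm \<theta> s h f"
      using bound[of h'] sm[OF f] by auto
    have "gs_norm \<theta> s h f < \<infinity>" using f hC(1) by (auto simp: beurling_def gs_space_def)
    then have "gs_norm \<theta> s h' (T f) < \<infinity>"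
      by (intro le_less_trans[OF hC(3)]) (auto simp: ennreal_mult_less_top)
    then show "T f \<in> gs_space \<theta> s h'" using sm[OF f] by (simp add: gs_space_def smooth)
  qed
  show "\<exists>p\<in>gs_norm \<theta> s ` {0<..}. \<exists>C>0. \<forall>f\<in>beurling \<theta> s. \<forall>g\<in>beurling \<theta> s.
      p' (\<lambda>x. T f x - T g x) \<le> ennreal C * p (\<lambda>x. f x - g x)"
    if "p' \<in> gs_norm \<theta> s ` {0<..}" for p' :: "(real^'n \<Rightarrow> complex) \<Rightarrow> ennreal"
  proof -
    obtain h' where h': "h' > 0" "p' = gs_norm \<theta> s h'" using \<open>p' \<in> _\<close> by auto
    obtain h C where "h > 0" "C > 0"
      "\<And>f. smooth f \<Longrightarrow> gs_norm \<theta> s h' (T f) \<le> ennreal C * gs_norm \<theta> s h f"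
      using bound[OF h'(1)] by blast
    then show ?thesis unfolding h'(2) diff
      by (intro bexI[of _ "gs_norm \<theta> s h"] exI[of _ C]) (auto intro: smooth_diff sm)
  qed
  show "p (\<lambda>x. f x - k x) \<le> p (\<lambda>x. f x - g x) + p (\<lambda>x. g x - k x)"
    if "p \<in> gs_norm \<theta> s ` {0<..}" "f \<in> beurling \<theta> s" "g \<in> beurling \<theta> s" "k \<in> beurling \<theta> s"
    for p and f g k :: "real^'n \<Rightarrow> complex"
    using that by (auto intro!: gs_norm_triangle sm)
qed (auto simp: gs_norm_zero)

theorem theorem1p1:
  fixes q :: "real^'n::finite \<Rightarrow> real" and m :: nat and s \<theta> :: real
  assumes "real_poly_of_degree q m" and "m \<ge> 2" and "s > 0" and "\<theta> > 0"
  shows "(s \<ge> (real m - 1) * \<theta> \<and> (real m - 1) * \<theta> \<ge> 1 \<longrightarrow>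
           continuous_map (roumieu_topology \<theta> s) (roumieu_topology \<theta> s) (exp_mult q)) \<and>
         (s \<ge> (real m - 1) * \<theta> \<and> (real m - 1) * \<theta> \<ge> 1 \<and> (\<theta>, s) \<noteq> (1 / (real m - 1), 1) \<longrightarrow>
           continuous_map (beurling_topology \<theta> s) (beurling_topology \<theta> s) (exp_mult q))"
proof (cases "s \<ge> (real m - 1) * \<theta> \<and> (real m - 1) * \<theta> \<ge> 1")
  case True
  then obtain K where K: "K > 0" and bound: "\<And>h. h > 0 \<Longrightarrow> \<exists>C>0. \<forall>f. smooth f \<longrightarrow>
    gs_norm \<theta> s (K * (h + h ^ (m - 1))) (exp_mult q f) \<le> ennreal C * gs_norm \<theta> s h f"
    using gs_norm_exp_mult_bound[OF assms(1,2,4)] by blast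
  note smooth = smooth_exp_mult_poly[OF assms(1)]
  have "continuous_map (roumieu_topology \<theta> s) (roumieu_topology \<theta> s) (exp_mult q)"
  proof (rule continuous_map_roumieu_topology[OF exp_mult_lin])
    fix h :: real assume h: "h > 0"
    then have h': "K * (h + h ^ (m - 1)) > 0" using K by (simp add: add_pos_pos)
    obtain C where "C > 0" "\<And>f. smooth f \<Longrightarrow>
      gs_norm \<theta> s (K * (h + h ^ (m - 1))) (exp_mult q f) \<le> ennreal C * gs_norm \<theta> s h f"
      using bound[OF h] by blast
    with h h' show "\<exists>h'>0. continuous_map (gs_topology \<theta> s h) (gs_topology \<theta> s h') (exp_mult q)"
      using continuous_map_gs_topology[of h "K * (h + h ^ (m - 1))" C "exp_mult q"]
        smooth exp_mult_diff by blast
  qed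
  moreover have "continuous_map (beurling_topology \<theta> s) (beurling_topology \<theta> s) (exp_mult q)"
  proof (rule continuous_map_beurling_topology[OF smooth exp_mult_diff])
    fix h' :: real assume h': "h' > 0"
    \<comment> \<open>For \<open>h \<le> 1\<close> the new parameter is at most \<open>2 * K * h\<close>.\<close>
    define h where "h = min 1 (h' / (2 * K))"
    have h: "h > 0" "h \<le> 1" "h \<le> h' / (2 * K)" using h' K by (auto simp: h_def)
    have "h ^ (m - 1) \<le> h ^ 1" using h assms(2) by (intro power_decreasing) auto
    then have "K * (h + h ^ (m - 1)) \<le> K * (2 * (h' / (2 * K)))"
      using h K by (intro mult_left_mono) auto
    then have le: "K * (h + h ^ (m - 1)) \<le> h'" using K by simp
    have pos: "K * (h + h ^ (m - 1)) > 0" using K h by (simp add: add_pos_pos)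
    obtain C where "C > 0" "\<And>f. smooth f \<Longrightarrow>
      gs_norm \<theta> s (K * (h + h ^ (m - 1))) (exp_mult q f) \<le> ennreal C * gs_norm \<theta> s h f"
      using bound[OF h(1)] by blast
    then show "\<exists>h>0. \<exists>C>0. \<forall>f. smooth f \<longrightarrow>
      gs_norm \<theta> s h' (exp_mult q f) \<le> ennreal C * gs_norm \<theta> s h f"
      using h(1) gs_norm_mono[OF pos le] order_trans by blast
  qed
  ultimately show ?thesis by blast
qed auto

end
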